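(* Let $G$ be a non-archimedean Hausdorff topological group. Then $G$ is amenable if and only if, for every open subgroup $H \leq G$, every minimal subflow of the $G$-flow $\alpha_{H} \colon G \to \mathrm{Aut}(2^{H\backslash G})$ is amenable, where $$\alpha_{H}(g)(\phi)(Hx) = \phi(Hxg) \qquad (g,x \in G,\ \phi \in 2^{H\backslash G}) .$$
   Context: A topological group is non-archimedean if every neighborhood of the neutral element contains an open subgroup. For $H\le G$, $H\backslash G=\{Hx: x\in G\}$; $2^{H\backslash G}$ is the compact Hausdorff space of all maps $H\backslash G\to\{0,1\}$ with the product topology. Flows: for a non-empty compact Hausdorff space $X$ (with its unique compatible uniformity), $\mathrm{Aut}(X)$ is the group of homeomorphisms of $X$ with the topology of uniform convergence. A $G$-flow on $X$ is a continuous homomorphism $\alpha\colon G\to\mathrm{Aut}(X)$. A set $Y\subseteq X$ is $\alpha$-invariant if $\alpha(g)(Y)=Y$ for all $g\in G$. The flow is minimal if $\emptyset$ and $X$ are the only closed $\alpha$-invariant subsets of $X$. A subflow of $\alpha$ is a flow $G\to\mathrm{Aut}(Y)$, $g\mapsto\alpha(g)|_Y$, where $Y$ is a (non-empty) closed $\alpha$-invariant subset. A flow $\alpha$ on $X$ is amenable if there is a linear map $\nu\colon C(X)\to\mathbb{R}$ on the space of continuous real functions with $\inf_X f\le\nu(f)\le\sup_X f$ and $\nu(f\circ\alpha(g))=\nu(f)$ for all $f\in C(X)$, $g\in G$. Amenable groups: a function $f\colon G\to\mathbb{R}$ is uniformly continuous for the right uniformity ($G_r$) if for every $\epsilon>0$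 there is an identity neighborhood $U$ with $|f(x)-f(y)|\le\epsilon$ whenever $xy^{-1}\in U$; ${\rm UC}_b(G_r)$ is the space of bounded such functions. The topological group $G$ is amenable if there is a linear map $\nu\colon {\rm UC}_b(G_r)\to\mathbb{R}$ with $\inf_G f\le\nu(f)\le\sup_G f$ and $\nu(f\circ\lambda_G(g))=\nu(f)$ for all $f\in{\rm UC}_b(G_r)$ and $g\in G$, where $\lambda_G(g)(x)=gx$. *)

theory Defs
  imports "HOL-Analysis.Analysis" "HOL-Algebra.Coset" "HOL-Algebra.Bij"
begin

section \<open>Topological groups\<close>

definition topological_group :: "('g, 'm) monoid_scheme \<Rightarrow> 'g topology \<Rightarrow> bool" where
  "topological_group G T \<longleftrightarrow>
     group G \<and> topspace T = carrier G \<and>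
     continuous_map (prod_topology T T) T (\<lambda>(x, y). x \<otimes>\<^bsub>G\<^esub> y) \<and>
     continuous_map T T (\<lambda>x. inv\<^bsub>G\<^esub> x)"

definition identity_nbhd :: "('g, 'm) monoid_scheme \<Rightarrow> 'g topology \<Rightarrow> 'g set \<Rightarrow> bool" where
  "identity_nbhd G T N \<longleftrightarrow> N \<subseteq> carrier G \<and> (\<exists>U. openin T U \<and> \<one>\<^bsub>G\<^esub> \<in> U \<and> U \<subseteq> N)"

definition open_subgroup :: "('g, 'm) monoid_scheme \<Rightarrow> 'g topology \<Rightarrow> 'g set \<Rightarrow> bool" where
  "open_subgroup G T H \<longleftrightarrow> subgroup H G \<and> openin T H"

definition non_archimedean :: "('g, 'm) monoid_scheme \<Rightarrow> 'g topology \<Rightarrow> bool" where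
  "non_archimedean G T \<longleftrightarrow>
     (\<forall>N. identity_nbhd G T N \<longrightarrow> (\<exists>H. open_subgroup G T H \<and> H \<subseteq> N))"


section \<open>Means and amenable topological groups\<close>

text \<open>Real functions on a set \<open>S\<close> are represented by the functions in \<^term>\<open>extensional S\<close>, so that
  they are determined by their values on \<open>S\<close>.  For a space \<open>F\<close> of bounded functions on \<open>S\<close>, closed
  under pointwise addition and scalar multiplication, a mean is a linear functional lying between
  the infimum and the supremum; its values outside \<open>F\<close> are irrelevant.\<close>

definition mean_on :: "'s set \<Rightarrow> ('s \<Rightarrow> real) set \<Rightarrow> (('s \<Rightarrow> real) \<Rightarrow> real) \<Rightarrow> bool" where
  "mean_on S F \<nu> \<longleftrightarrow>
     (\<forall>f\<in>F. \<forall>h\<in>F. \<nu> (\<lambda>x\<in>S. f x + h x) = \<nu> f + \<nu> h) \<and>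
     (\<forall>c. \<forall>f\<in>F. \<nu> (\<lambda>x\<in>S. c * f x) = c * \<nu> f) \<and>
     (\<forall>f\<in>F. (INF x\<in>S. f x) \<le> \<nu> f \<and> \<nu> f \<le> (SUP x\<in>S. f x))"

definition UCb_right :: "('g, 'm) monoid_scheme \<Rightarrow> 'g topology \<Rightarrow> ('g \<Rightarrow> real) set" where
  "UCb_right G T =
     {f \<in> extensional (carrier G).
        bounded (f ` carrier G) \<and>
        (\<forall>\<epsilon>>0. \<exists>U. identity_nbhd G T U \<and>
           (\<forall>x\<in>carrier G. \<forall>y\<in>carrier G. x \<otimes>\<^bsub>G\<^esub> inv\<^bsub>G\<^esub> y \<in> U \<longrightarrow> \<bar>f x - f y\<bar> \<le> \<epsilon>))}"

definition amenable_group :: "('g, 'm) monoid_scheme \<Rightarrow> 'g topology \<Rightarrow> bool" where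
  "amenable_group G T \<longleftrightarrow>
     (\<exists>\<nu>. mean_on (carrier G) (UCb_right G T) \<nu> \<and>
          (\<forall>f\<in>UCb_right G T. \<forall>g\<in>carrier G. \<nu> (compose (carrier G) f (\<lambda>x. g \<otimes>\<^bsub>G\<^esub> x)) = \<nu> f))"


section \<open>The uniformity of a compact Hausdorff space\<close>

definition is_uniformity :: "'x set \<Rightarrow> ('x \<times> 'x) set set \<Rightarrow> bool" where
  "is_uniformity S \<U> \<longleftrightarrow>
     \<U> \<noteq> {} \<and>
     (\<forall>E\<in>\<U>. Id_on S \<subseteq> E \<and> E \<subseteq> S \<times> S) \<and>
     (\<forall>E\<in>\<U>. \<forall>D. E \<subseteq> D \<and> D \<subseteq> S \<times> S \<longrightarrow> D \<in> \<U>) \<and>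
     (\<forall>E\<in>\<U>. \<forall>D\<in>\<U>. E \<inter> D \<in> \<U>) \<and>
     (\<forall>E\<in>\<U>. E\<inverse> \<in> \<U>) \<and>
     (\<forall>E\<in>\<U>. \<exists>D\<in>\<U>. D O D \<subseteq> E)"

definition compatible_uniformity :: "'x topology \<Rightarrow> ('x \<times> 'x) set set \<Rightarrow> bool" where
  "compatible_uniformity X \<U> \<longleftrightarrow>
     is_uniformity (topspace X) \<U> \<and>
     (\<forall>W. openin X W \<longleftrightarrow> W \<subseteq> topspace X \<and> (\<forall>x\<in>W. \<exists>E\<in>\<U>. E `` {x} \<subseteq> W))"

text \<open>Meaningful for compact Hausdorff \<open>X\<close>; see \<open>compact_Hausdorff_ex1_uniformity\<close> below.\<close>

definition the_uniformity :: "'x topology \<Rightarrow> ('x \<times> 'x) set set" where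
  "the_uniformity X = (THE \<U>. compatible_uniformity X \<U>)"

lemma is_uniformityD:
  assumes "is_uniformity S \<U>"
  shows "\<U> \<noteq> {}"
    and "\<And>E. E \<in> \<U> \<Longrightarrow> Id_on S \<subseteq> E"
    and "\<And>E. E \<in> \<U> \<Longrightarrow> E \<subseteq> S \<times> S"
    and "\<And>E D. E \<in> \<U> \<Longrightarrow> E \<subseteq> D \<Longrightarrow> D \<subseteq> S \<times> S \<Longrightarrow> D \<in> \<U>"
    and "\<And>E D. E \<in> \<U> \<Longrightarrow> D \<in> \<U> \<Longrightarrow> E \<inter> D \<in> \<U>"
    and "\<And>E. E \<in> \<U> \<Longrightarrow> E\<inverse> \<in> \<U>"
    and "\<And>E. E \<in> \<U> \<Longrightarrow> \<exists>D\<in>\<U>. D O D \<subseteq> E"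
proof -
  have a: "\<forall>E\<in>\<U>. Id_on S \<subseteq> E \<and> E \<subseteq> S \<times> S"
    using assms unfolding is_uniformity_def by (elim conjE)
  have b: "\<forall>E\<in>\<U>. \<forall>D. E \<subseteq> D \<and> D \<subseteq> S \<times> S \<longrightarrow> D \<in> \<U>"
    using assms unfolding is_uniformity_def by (elim conjE)
  show "\<U> \<noteq> {}"
    using assms unfolding is_uniformity_def by (elim conjE)
  show "Id_on S \<subseteq> E" "E \<subseteq> S \<times> S" if "E \<in> \<U>" for E
    using a that by blast+
  show "D \<in> \<U>" if "E \<in> \<U>" "E \<subseteq> D" "D \<subseteq> S \<times> S" for E D
    using b that by blast
  show "E \<inter> D \<in> \<U>" if "E \<in> \<U>" "D \<in> \<U>" for E D
  proof -
    have "\<forall>E\<in>\<U>. \<forall>D\<in>\<U>. E \<inter> D \<in> \<U>"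
      using assms unfolding is_uniformity_def by (elim conjE)
    then show ?thesis using that by blast
  qed
  show "E\<inverse> \<in> \<U>" if "E \<in> \<U>" for E
    using assms that unfolding is_uniformity_def by (elim conjE) (rule bspec)
  show "\<exists>D\<in>\<U>. D O D \<subseteq> E" if "E \<in> \<U>" for E
    using assms that unfolding is_uniformity_def by (elim conjE) (rule bspec)
qed

lemma is_uniformity_finite_Inter:
  assumes U: "is_uniformity S \<U>" and "finite I" "\<And>i. i \<in> I \<Longrightarrow> E i \<in> \<U>"
  shows "\<exists>D\<in>\<U>. \<forall>i\<in>I. D \<subseteq> E i"
  using assms(2,3)
proof (induction I)
  case empty
  then show ?case using is_uniformityD(1)[OF U] by auto
next
  case (insert i I)
  then obtain D where "D \<in> \<U>" "\<forall>i\<in>I. D \<subseteq> E i" by auto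
  then show ?case
    using is_uniformityD(5)[OF U, of D "E i"] insert.prems by (intro bexI[of _ "D \<inter> E i"]) auto
qed

definition diagonal_nbhds :: "'x topology \<Rightarrow> ('x \<times> 'x) set set" where
  "diagonal_nbhds X =
     {E. E \<subseteq> topspace X \<times> topspace X \<and>
         (\<exists>W. openin (prod_topology X X) W \<and> Id_on (topspace X) \<subseteq> W \<and> W \<subseteq> E)}"

lemma compatible_uniformity_interior:
  assumes C: "compatible_uniformity X \<U>" and E: "E \<in> \<U>" and x: "x \<in> topspace X"
  obtains V where "openin X V" "x \<in> V" "V \<subseteq> E `` {x}"
proof
  have U: "is_uniformity (topspace X) \<U>"
    and op: "\<And>W. openin X W \<longleftrightarrow> W \<subseteq> topspace X \<and> (\<forall>x\<in>W. \<exists>E\<in>\<U>. E `` {x} \<subseteq> W)"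
    using C by (simp_all add: compatible_uniformity_def)
  define V where "V = {y \<in> topspace X. \<exists>D\<in>\<U>. D `` {y} \<subseteq> E `` {x}}"
  show "x \<in> V" using E x by (auto simp: V_def)
  show "V \<subseteq> E `` {x}" using is_uniformityD(2)[OF U] by (fastforce simp: V_def)
  show "openin X V"
    unfolding op
  proof (intro conjI ballI)
    fix y assume "y \<in> V"
    then obtain D where D: "D \<in> \<U>" "D `` {y} \<subseteq> E `` {x}" by (auto simp: V_def)
    obtain D' where D': "D' \<in> \<U>" "D' O D' \<subseteq> D" using is_uniformityD(7)[OF U D(1)] by blast
    have "D' `` {y} \<subseteq> V"
    proof
      fix z assume z: "z \<in> D' `` {y}"
      then have "D' `` {z} \<subseteq> E `` {x}" using D D' by blast
      moreover have "z \<in> topspace X" using is_uniformityD(3)[OF U D'(1)] z by auto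
      ultimately show "z \<in> V" using D'(1) by (auto simp: V_def)
    qed
    then show "\<exists>D\<in>\<U>. D `` {y} \<subseteq> V" using D'(1) by blast
  qed (auto simp: V_def)
qed

lemma compatible_uniformity_unique:
  assumes cpt: "compact_space X" and C: "compatible_uniformity X \<U>"
  shows "\<U> = diagonal_nbhds X"
proof (intro subset_antisym subsetI)
  have U: "is_uniformity (topspace X) \<U>"
    and op: "\<And>W. openin X W \<longleftrightarrow> W \<subseteq> topspace X \<and> (\<forall>x\<in>W. \<exists>E\<in>\<U>. E `` {x} \<subseteq> W)"
    using C by (simp_all add: compatible_uniformity_def)
  { fix E assume E: "E \<in> \<U>"
    obtain D where D: "D \<in> \<U>" "D O D \<subseteq> E" using is_uniformityD(7)[OF U E] by blast
    define F where "F = D \<inter> D\<inverse>"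
    have F: "F \<in> \<U>" unfolding F_def using is_uniformityD(5,6)[OF U] D(1) by blast
    have "\<exists>V. openin X V \<and> x \<in> V \<and> V \<subseteq> F `` {x}" if "x \<in> topspace X" for x
      using compatible_uniformity_interior[OF C F that] by metis
    then obtain V where V: "\<And>x. x \<in> topspace X \<Longrightarrow> openin X (V x) \<and> x \<in> V x \<and> V x \<subseteq> F `` {x}"
      by metis
    define W where "W = (\<Union>x\<in>topspace X. V x \<times> V x)"
    have "openin (prod_topology X X) W" unfolding W_def using V
      by (auto simp: openin_prod_Times_iff)
    moreover have "Id_on (topspace X) \<subseteq> W" using V by (auto simp: W_def)
    moreover have "W \<subseteq> E"
    proof
      fix p assume "p \<in> W"
      then obtain x a b where "x \<in> topspace X" "p = (a, b)" "a \<in> V x" "b \<in> V x"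
        by (auto simp: W_def)
      then have "(a, x) \<in> D" "(x, b) \<in> D" using V[of x] by (auto simp: F_def)
      then show "p \<in> E" using D(2) \<open>p = (a, b)\<close> by blast
    qed
    ultimately show "E \<in> diagonal_nbhds X"
      using is_uniformityD(3)[OF U E] unfolding diagonal_nbhds_def by blast }
  { fix E assume "E \<in> diagonal_nbhds X"
    then obtain W where W: "openin (prod_topology X X) W" "Id_on (topspace X) \<subseteq> W" "W \<subseteq> E"
      and E: "E \<subseteq> topspace X \<times> topspace X" by (auto simp: diagonal_nbhds_def)
    have "\<exists>D V. D \<in> \<U> \<and> openin X V \<and> x \<in> V \<and> V \<subseteq> D `` {x} \<and>
                (D O D) `` {x} \<times> (D O D) `` {x} \<subseteq> W" if x: "x \<in> topspace X" for x
    proof -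
      have "(x, x) \<in> W" using W(2) x by auto
      then obtain A B where AB: "openin X A" "openin X B" "x \<in> A" "x \<in> B" "A \<times> B \<subseteq> W"
        using W(1) unfolding openin_prod_topology_alt by meson
      then have "openin X (A \<inter> B)" "x \<in> A \<inter> B" by auto
      then obtain E' where E': "E' \<in> \<U>" "E' `` {x} \<subseteq> A \<inter> B" using op by meson
      obtain D where D: "D \<in> \<U>" "D O D \<subseteq> E'" using is_uniformityD(7)[OF U E'(1)] by blast
      obtain V where "openin X V" "x \<in> V" "V \<subseteq> D `` {x}"
        using compatible_uniformity_interior[OF C D(1) x] by metis
      moreover have "(D O D) `` {x} \<times> (D O D) `` {x} \<subseteq> W" using D E' AB(5) by blast
      ultimately show ?thesis using D(1) by blast
    qed
    then obtain D V where DV: "\<And>x. x \<in> topspace X \<Longrightarrow> D x \<in> \<U> \<and> openin X (V x) \<and> x \<in> V x \<and>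
        V x \<subseteq> D x `` {x} \<and> (D x O D x) `` {x} \<times> (D x O D x) `` {x} \<subseteq> W"
      by metis
    have "\<exists>\<F>. finite \<F> \<and> \<F> \<subseteq> V ` topspace X \<and> topspace X \<subseteq> \<Union>\<F>"
    proof (rule cpt[unfolded compact_space_alt, rule_format], intro conjI ballI subsetI)
      show "openin X U" if "U \<in> V ` topspace X" for U using DV that by fast
      show "x \<in> \<Union>(V ` topspace X)" if "x \<in> topspace X" for x using DV[OF that] that by fast
    qed
    then obtain I where I: "finite I" "I \<subseteq> topspace X" "topspace X \<subseteq> (\<Union>x\<in>I. V x)"
      by (metis finite_subset_image)
    obtain F where F: "F \<in> \<U>" "\<forall>x\<in>I. F \<subseteq> D x"
      using is_uniformity_finite_Inter[OF U I(1), of D] I(2) DV by blast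
    have "F \<subseteq> W"
    proof
      fix p assume p: "p \<in> F"
      obtain a b where ab: "p = (a, b)" by force
      have "a \<in> topspace X" "b \<in> topspace X" using p is_uniformityD(3)[OF U F(1)] ab by auto
      then obtain x where x: "x \<in> I" "a \<in> V x" using I(3) by auto
      have xt: "x \<in> topspace X" using x(1) I(2) by auto
      have 1: "(x, a) \<in> D x" using DV[OF xt] x(2) by auto
      have 2: "(a, b) \<in> D x" "(a, a) \<in> D x"
        using F(2) x(1) p ab is_uniformityD(2)[OF U, of "D x"] DV[OF xt] \<open>a \<in> topspace X\<close> by auto
      show "p \<in> W" using DV[OF xt] 1 2 ab by blast
    qed
    then show "E \<in> \<U>" using is_uniformityD(4)[OF U F(1)] W(3) E by blast }
qed

lemma compatible_uniformity_diagonal_nbhds: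
  assumes cpt: "compact_space X" and haus: "Hausdorff_space X"
  shows "compatible_uniformity X (diagonal_nbhds X)"
proof -
  let ?S = "topspace X" and ?P = "prod_topology X X"
  have half: "\<exists>D\<in>diagonal_nbhds X. D O D \<subseteq> E" if E: "E \<in> diagonal_nbhds X" for E
  proof -
    obtain W where W: "openin ?P W" "Id_on ?S \<subseteq> W" "W \<subseteq> E"
      using E by (auto simp: diagonal_nbhds_def)
    have "completely_regular_space X" "t1_space X"
      using cpt haus
      by (auto intro: normal_imp_completely_regular_space_A compact_Hausdorff_or_regular_imp_normal_space
          Hausdorff_imp_t1_space)
    then have sep: "\<exists>h. continuous_map X euclideanreal h \<and> h x = 0 \<and> h y = 1"
      if "x \<in> ?S" "y \<in> ?S" "x \<noteq> y" for x y
    proof -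
      have "closedin X {y}" using \<open>t1_space X\<close> that(2) closedin_t1_singleton by fastforce
      moreover have "x \<in> ?S - {y}" using that by blast
      ultimately obtain h where "continuous_map X euclideanreal h" "h x = 0" "h ` {y} \<subseteq> {1}"
        using \<open>completely_regular_space X\<close> unfolding completely_regular_space_alt by meson
      then show ?thesis by blast
    qed
    define K where "K = topspace ?P - W"
    have "compactin ?P K"
      unfolding K_def using W(1) cpt compact_space_prod_topology[of X X]
    by (intro closedin_compact_space closedin_diff closedin_topspace) blast+
    have "\<exists>h. continuous_map X euclideanreal h \<and> h (fst p) = 0 \<and> h (snd p) = 1" if "p \<in> K" for p
      using that sep[of "fst p" "snd p"] W(2) by (cases p) (auto simp: K_def Id_on_def)
    then obtain h where h: "\<And>p. p \<in> K \<Longrightarrow>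
        continuous_map X euclideanreal (h p) \<and> h p (fst p) = 0 \<and> h p (snd p) = 1" by metis
    define N where "N p = {x \<in> ?S. h p x \<in> {..<1/4}} \<times> {x \<in> ?S. h p x \<in> {3/4<..}}" for p
    have opN: "openin ?P (N p)" if "p \<in> K" for p
      unfolding N_def openin_prod_Times_iff using h[OF that]
      by (intro disjI2 conjI openin_continuous_map_preimage[of X euclideanreal]) auto
    have "K \<subseteq> \<Union>(N ` K)"
      using h by (fastforce simp: N_def K_def)
    then obtain \<F> where "finite \<F>" "\<F> \<subseteq> N ` K" "K \<subseteq> \<Union>\<F>"
      using \<open>compactin ?P K\<close> opN unfolding compactin_def by (metis (no_types, lifting) imageE)
    then obtain I where I: "finite I" "I \<subseteq> K" "K \<subseteq> (\<Union>p\<in>I. N p)"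
      by (metis finite_subset_image)
    define D where "D = {z \<in> topspace ?P. \<forall>p\<in>I. h p (fst z) - h p (snd z) \<in> {-1/4<..<1/4}}"
    have "openin ?P {z \<in> topspace ?P. h p (fst z) - h p (snd z) \<in> {-1/4<..<1/4}}" if "p \<in> I" for p
    proof (rule openin_continuous_map_preimage[where Y = euclideanreal])
      have c: "continuous_map X euclideanreal (h p)" using h I(2) that by blast
      show "continuous_map ?P euclideanreal (\<lambda>z. h p (fst z) - h p (snd z))"
        using continuous_map_compose[OF continuous_map_fst c] continuous_map_compose[OF continuous_map_snd c]
        by (intro continuous_map_diff) (auto simp: o_def)
    qed auto
    then have "openin ?P (topspace ?P \<inter> (\<Inter>p\<in>I. {z \<in> topspace ?P. h p (fst z) - h p (snd z) \<in> {-1/4<..<1/4}}))"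
      by (subst Int_commute) (rule openin_INT[OF I(1)])
    also have "topspace ?P \<inter> (\<Inter>p\<in>I. {z \<in> topspace ?P. h p (fst z) - h p (snd z) \<in> {-1/4<..<1/4}}) = D"
      by (auto simp: D_def)
    finally have "D \<in> diagonal_nbhds X"
      by (auto simp: diagonal_nbhds_def D_def intro!: exI[of _ D])
    moreover have "D O D \<subseteq> W"
    proof (rule ccontr)
      assume "\<not> D O D \<subseteq> W"
      then obtain a b c where abc: "(a, b) \<in> D" "(b, c) \<in> D" "(a, c) \<notin> W" by auto
      then have "(a, c) \<in> K" by (auto simp: K_def D_def)
      then obtain p where "p \<in> I" "(a, c) \<in> N p" using I(3) by blast
      then show False using abc(1,2) by (force simp: N_def D_def)
    qed
    ultimately show ?thesis using W(3) by blast
  qed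
  have "is_uniformity ?S (diagonal_nbhds X)"
    unfolding is_uniformity_def
  proof (intro conjI ballI allI impI)
    show "diagonal_nbhds X \<noteq> {}"
      by (auto simp: diagonal_nbhds_def intro!: exI[of _ "?S \<times> ?S"] simp: openin_prod_Times_iff)
    fix E assume E: "E \<in> diagonal_nbhds X"
    then obtain W where W: "openin ?P W" "Id_on ?S \<subseteq> W" "W \<subseteq> E" "E \<subseteq> ?S \<times> ?S"
      by (auto simp: diagonal_nbhds_def)
    show "Id_on ?S \<subseteq> E" "E \<subseteq> ?S \<times> ?S" using W by auto
    show "\<exists>D\<in>diagonal_nbhds X. D O D \<subseteq> E" by (rule half[OF E])
    show "D \<in> diagonal_nbhds X" if "E \<subseteq> D \<and> D \<subseteq> ?S \<times> ?S" for D
      using that W unfolding diagonal_nbhds_def by blast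
    show "E\<inverse> \<in> diagonal_nbhds X"
    proof -
      have "openin ?P {z \<in> topspace ?P. (\<lambda>(x, y). (y, x)) z \<in> W}"
        by (rule openin_continuous_map_preimage[OF _ W(1)]) (simp add: case_prod_unfold continuous_map_pairedI continuous_map_fst continuous_map_snd)
      moreover have "{z \<in> topspace ?P. (\<lambda>(x, y). (y, x)) z \<in> W} = W\<inverse>"
        using W(3,4) by auto
      ultimately show ?thesis
        using W unfolding diagonal_nbhds_def by (auto intro!: exI[of _ "W\<inverse>"])
    qed
    fix D assume "D \<in> diagonal_nbhds X"
    then obtain V where V: "openin ?P V" "Id_on ?S \<subseteq> V" "V \<subseteq> D"
      by (auto simp: diagonal_nbhds_def)
    have "openin ?P (W \<inter> V)" "Id_on ?S \<subseteq> W \<inter> V" "W \<inter> V \<subseteq> E \<inter> D" "E \<inter> D \<subseteq> ?S \<times> ?S"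
      using W V by auto
    then show "E \<inter> D \<in> diagonal_nbhds X" unfolding diagonal_nbhds_def by blast
  qed
  moreover have "openin X W \<longleftrightarrow> W \<subseteq> ?S \<and> (\<forall>x\<in>W. \<exists>E\<in>diagonal_nbhds X. E `` {x} \<subseteq> W)" for W
  proof (intro iffI conjI ballI)
    assume W: "openin X W"
    then show "W \<subseteq> ?S" by (rule openin_subset)
    fix x assume x: "x \<in> W"
    then have xt: "x \<in> ?S" using \<open>W \<subseteq> ?S\<close> by auto
    define E where "E = W \<times> W \<union> (?S - {x}) \<times> ?S"
    have "openin X (?S - {x})"
      by (rule openin_diff[OF openin_topspace closedin_Hausdorff_singleton[OF haus xt]])
    then have "openin ?P E" using W unfolding E_def by (auto intro!: openin_Un simp: openin_prod_Times_iff)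
    moreover have "Id_on ?S \<subseteq> E" "E \<subseteq> ?S \<times> ?S" using x \<open>W \<subseteq> ?S\<close> by (auto simp: E_def)
    ultimately have "E \<in> diagonal_nbhds X" unfolding diagonal_nbhds_def by blast
    moreover have "E `` {x} \<subseteq> W" by (auto simp: E_def)
    ultimately show "\<exists>E\<in>diagonal_nbhds X. E `` {x} \<subseteq> W" by blast
  next
    assume W: "W \<subseteq> ?S \<and> (\<forall>x\<in>W. \<exists>E\<in>diagonal_nbhds X. E `` {x} \<subseteq> W)"
    show "openin X W"
    proof (subst openin_subopen, intro ballI)
      fix x assume x: "x \<in> W"
      then obtain E where E: "E \<in> diagonal_nbhds X" "E `` {x} \<subseteq> W" using W by meson
      then obtain V where V: "openin ?P V" "Id_on ?S \<subseteq> V" "V \<subseteq> E"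
        unfolding diagonal_nbhds_def by blast
      then have "(x, x) \<in> V" using x W by auto
      then obtain A B where "openin X A" "openin X B" "x \<in> A" "x \<in> B" "A \<times> B \<subseteq> V"
        using V(1) unfolding openin_prod_topology_alt by meson
      then show "\<exists>T. openin X T \<and> x \<in> T \<and> T \<subseteq> W" using V(3) E(2) by blast
    qed
  qed
  ultimately show ?thesis unfolding compatible_uniformity_def by blast
qed

theorem compact_Hausdorff_ex1_uniformity:
  assumes "compact_space X" "Hausdorff_space X"
  shows "\<exists>!\<U>. compatible_uniformity X \<U>"
  by (rule ex1I[where a = "diagonal_nbhds X"])
     (rule compatible_uniformity_diagonal_nbhds[OF assms], rule compatible_uniformity_unique[OF assms(1)])

corollary the_uniformity_eq:
  assumes "compact_space X" "Hausdorff_space X"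
  shows "the_uniformity X = diagonal_nbhds X"
  unfolding the_uniformity_def
  by (rule the_equality)
     (rule compatible_uniformity_diagonal_nbhds[OF assms], rule compatible_uniformity_unique[OF assms(1)])


section \<open>Flows\<close>

text \<open>The group operation of \<^const>\<open>BijGroup\<close> is composition.\<close>

definition Aut :: "'x topology \<Rightarrow> ('x \<Rightarrow> 'x) monoid" where
  "Aut X = (BijGroup (topspace X))
     \<lparr>carrier := {f \<in> extensional (topspace X). homeomorphic_map X X f}\<rparr>"

definition Aut_topology :: "'x topology \<Rightarrow> ('x \<Rightarrow> 'x) topology" where
  "Aut_topology X = topology (\<lambda>W. W \<subseteq> carrier (Aut X) \<and>
     (\<forall>f\<in>W. \<exists>E\<in>the_uniformity X.
        {f' \<in> carrier (Aut X). \<forall>x\<in>topspace X. (f x, f' x) \<in> E} \<subseteq> W))"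

lemma openin_Aut_topology:
  assumes "compact_space X" "Hausdorff_space X"
  shows "openin (Aut_topology X) W \<longleftrightarrow> W \<subseteq> carrier (Aut X) \<and>
     (\<forall>f\<in>W. \<exists>E\<in>the_uniformity X.
        {f' \<in> carrier (Aut X). \<forall>x\<in>topspace X. (f x, f' x) \<in> E} \<subseteq> W)"
proof -
  have "is_uniformity (topspace X) (the_uniformity X)"
    using compatible_uniformity_diagonal_nbhds[OF assms]
    by (simp add: the_uniformity_eq[OF assms] compatible_uniformity_def)
  note U = is_uniformityD(5)[OF this]
  let ?N = "\<lambda>f E. {f' \<in> carrier (Aut X). \<forall>x\<in>topspace X. (f x, f' x) \<in> E}"
  have "istopology (\<lambda>W. W \<subseteq> carrier (Aut X) \<and> (\<forall>f\<in>W. \<exists>E\<in>the_uniformity X. ?N f E \<subseteq> W))"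
    unfolding istopology_def
  proof (intro conjI allI impI ballI)
    fix V W f
    assume V: "V \<subseteq> carrier (Aut X) \<and> (\<forall>f\<in>V. \<exists>E\<in>the_uniformity X. ?N f E \<subseteq> V)"
      and W: "W \<subseteq> carrier (Aut X) \<and> (\<forall>f\<in>W. \<exists>E\<in>the_uniformity X. ?N f E \<subseteq> W)"
    show "V \<inter> W \<subseteq> carrier (Aut X)" using V by blast
    assume f: "f \<in> V \<inter> W"
    obtain D where D: "D \<in> the_uniformity X" "?N f D \<subseteq> V" using V f by (meson IntD1)
    obtain E where E: "E \<in> the_uniformity X" "?N f E \<subseteq> W" using W f by (meson IntD2)
    have "?N f (D \<inter> E) \<subseteq> V \<inter> W" using D(2) E(2) by blast
    then show "\<exists>E\<in>the_uniformity X. ?N f E \<subseteq> V \<inter> W" using U[OF D(1) E(1)] by blast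
  next
    fix \<W>
    assume W: "\<forall>W\<in>\<W>. W \<subseteq> carrier (Aut X) \<and> (\<forall>f\<in>W. \<exists>E\<in>the_uniformity X. ?N f E \<subseteq> W)"
    show "\<Union>\<W> \<subseteq> carrier (Aut X)" using W by blast
    fix f assume "f \<in> \<Union>\<W>"
    then obtain W' where W': "W' \<in> \<W>" "f \<in> W'" by blast
    then obtain E where "E \<in> the_uniformity X" "?N f E \<subseteq> W'" using W by meson
    then show "\<exists>E\<in>the_uniformity X. ?N f E \<subseteq> \<Union>\<W>" using W'(1) by (meson Union_upper order_trans)
  qed
  then show ?thesis unfolding Aut_topology_def by (simp add: topology_inverse')
qed

definition flow :: "('g, 'm) monoid_scheme \<Rightarrow> 'g topology \<Rightarrow> 'x topology \<Rightarrow> ('g \<Rightarrow> 'x \<Rightarrow> 'x) \<Rightarrow> bool" where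
  "flow G T X \<alpha> \<longleftrightarrow>
     topspace X \<noteq> {} \<and> compact_space X \<and> Hausdorff_space X \<and>
     \<alpha> \<in> hom G (Aut X) \<and> continuous_map T (Aut_topology X) \<alpha>"

definition flow_invariant :: "('g, 'm) monoid_scheme \<Rightarrow> ('g \<Rightarrow> 'x \<Rightarrow> 'x) \<Rightarrow> 'x set \<Rightarrow> bool" where
  "flow_invariant G \<alpha> Y \<longleftrightarrow> (\<forall>g\<in>carrier G. \<alpha> g ` Y = Y)"

definition minimal_flow ::
    "('g, 'm) monoid_scheme \<Rightarrow> 'g topology \<Rightarrow> 'x topology \<Rightarrow> ('g \<Rightarrow> 'x \<Rightarrow> 'x) \<Rightarrow> bool" where
  "minimal_flow G T X \<alpha> \<longleftrightarrow>
     flow G T X \<alpha> \<and>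
     (\<forall>Y. closedin X Y \<and> flow_invariant G \<alpha> Y \<longrightarrow> Y = {} \<or> Y = topspace X)"

definition subflow ::
    "('g, 'm) monoid_scheme \<Rightarrow> 'g topology \<Rightarrow> 'x topology \<Rightarrow> ('g \<Rightarrow> 'x \<Rightarrow> 'x) \<Rightarrow>
     'x set \<Rightarrow> ('g \<Rightarrow> 'x \<Rightarrow> 'x) \<Rightarrow> bool" where
  "subflow G T X \<alpha> Y \<beta> \<longleftrightarrow>
     Y \<noteq> {} \<and> closedin X Y \<and> flow_invariant G \<alpha> Y \<and>
     \<beta> = (\<lambda>g. restrict (\<alpha> g) Y) \<and> flow G T (subtopology X Y) \<beta>"

definition continuous_functions :: "'x topology \<Rightarrow> ('x \<Rightarrow> real) set" where
  "continuous_functions X =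
     {f \<in> extensional (topspace X). continuous_map X euclideanreal f}"

definition amenable_flow ::
    "('g, 'm) monoid_scheme \<Rightarrow> 'g topology \<Rightarrow> 'x topology \<Rightarrow> ('g \<Rightarrow> 'x \<Rightarrow> 'x) \<Rightarrow> bool" where
  "amenable_flow G T X \<alpha> \<longleftrightarrow>
     flow G T X \<alpha> \<and>
     (\<exists>\<nu>. mean_on (topspace X) (continuous_functions X) \<nu> \<and>
          (\<forall>f\<in>continuous_functions X. \<forall>g\<in>carrier G. \<nu> (compose (topspace X) f (\<alpha> g)) = \<nu> f))"


section \<open>The coset flow\<close>

definition coset_cube :: "('g, 'm) monoid_scheme \<Rightarrow> 'g set \<Rightarrow> ('g set \<Rightarrow> nat) topology" where
  "coset_cube G H = product_topology (\<lambda>_. discrete_topology {0, 1}) (rcosets\<^bsub>G\<^esub> H)"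

text \<open>For \<open>C = Hx\<close> the translate \<^term>\<open>C #>\<^bsub>G\<^esub> g\<close> is the coset \<open>Hxg\<close>.\<close>

definition coset_flow ::
    "('g, 'm) monoid_scheme \<Rightarrow> 'g set \<Rightarrow> 'g \<Rightarrow> ('g set \<Rightarrow> nat) \<Rightarrow> ('g set \<Rightarrow> nat)" where
  "coset_flow G H g =
     (\<lambda>\<phi>\<in>topspace (coset_cube G H). \<lambda>C\<in>rcosets\<^bsub>G\<^esub> H. \<phi> (C #>\<^bsub>G\<^esub> g))"

lemma diagonal_nbhds_cube:
  fixes I :: "'i set" and A :: "'a set"
  defines "X \<equiv> product_topology (\<lambda>_. discrete_topology A) I"
  assumes A: "finite A" and E: "E \<in> diagonal_nbhds X"
  shows "\<exists>F. finite F \<and> F \<subseteq> I \<and>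
           {(\<phi>, \<psi>) \<in> topspace X \<times> topspace X. \<forall>i\<in>F. \<phi> i = \<psi> i} \<subseteq> E"
proof -
  let ?D = "\<lambda>F. {(\<phi>, \<psi>) \<in> topspace X \<times> topspace X. \<forall>i\<in>F. \<phi> i = \<psi> i}"
  define \<U> where "\<U> = {E. E \<subseteq> topspace X \<times> topspace X \<and> (\<exists>F. finite F \<and> F \<subseteq> I \<and> ?D F \<subseteq> E)}"
  have top: "topspace X = PiE I (\<lambda>_. A)" by (simp add: X_def)
  have "compact_space X"
    using A by (simp add: X_def compact_space_product_topology compact_space_discrete_topology)
  have base: "?D F \<in> \<U>" if "finite F" "F \<subseteq> I" for F using that by (auto simp: \<U>_def)
  have "is_uniformity (topspace X) \<U>"
    unfolding is_uniformity_def
  proof (intro conjI ballI allI impI)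
    show "\<U> \<noteq> {}" using base[of "{}"] by blast
    fix E assume "E \<in> \<U>"
    then obtain F where F: "finite F" "F \<subseteq> I" "?D F \<subseteq> E" and E: "E \<subseteq> topspace X \<times> topspace X"
      unfolding \<U>_def by blast
    show "Id_on (topspace X) \<subseteq> E" using F(3) by blast
    show "E \<subseteq> topspace X \<times> topspace X" by (rule E)
    show "D \<in> \<U>" if "E \<subseteq> D \<and> D \<subseteq> topspace X \<times> topspace X" for D
    proof -
      have "?D F \<subseteq> D" using F(3) that by blast
      then show ?thesis using that F(1,2) unfolding \<U>_def by blast
    qed
    show "\<exists>D\<in>\<U>. D O D \<subseteq> E"
    proof (rule bexI[OF _ base[OF F(1,2)]])
      have "?D F O ?D F \<subseteq> ?D F" by auto
      then show "?D F O ?D F \<subseteq> E" using F(3) by (rule order_trans)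
    qed
    have "?D F \<subseteq> E\<inverse>" using F(3) by fastforce
    then show "E\<inverse> \<in> \<U>" using E F(1,2) unfolding \<U>_def by blast
    fix D assume "D \<in> \<U>"
    then obtain F' where F': "finite F'" "F' \<subseteq> I" "?D F' \<subseteq> D" unfolding \<U>_def by blast
    have "?D (F \<union> F') \<subseteq> E \<inter> D" using F(3) F'(3) by blast
    moreover have "finite (F \<union> F')" "F \<union> F' \<subseteq> I" using F F' by auto
    moreover have "E \<inter> D \<subseteq> topspace X \<times> topspace X" using E by blast
    ultimately show "E \<inter> D \<in> \<U>" unfolding \<U>_def by blast
  qed
  moreover have "openin X W \<longleftrightarrow> W \<subseteq> topspace X \<and> (\<forall>\<phi>\<in>W. \<exists>E\<in>\<U>. E `` {\<phi>} \<subseteq> W)" for W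
  proof (intro iffI conjI ballI)
    assume W: "openin X W"
    then show "W \<subseteq> topspace X" by (rule openin_subset)
    fix \<phi> assume \<phi>: "\<phi> \<in> W"
    obtain V where V: "finite {i \<in> I. V i \<noteq> A}" "\<phi> \<in> PiE I V" "PiE I V \<subseteq> W"
      using W \<phi> unfolding X_def openin_product_topology_alt by (auto simp: topspace_discrete_topology)
    have "?D {i \<in> I. V i \<noteq> A} `` {\<phi>} \<subseteq> PiE I V"
    proof
      fix \<psi> assume "\<psi> \<in> ?D {i \<in> I. V i \<noteq> A} `` {\<phi>}"
      then have \<psi>: "\<psi> \<in> PiE I (\<lambda>_. A)" "\<And>i. i \<in> I \<Longrightarrow> V i \<noteq> A \<Longrightarrow> \<phi> i = \<psi> i" by (auto simp: top)
      show "\<psi> \<in> PiE I V"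
      proof (rule PiE_I)
        fix i assume i: "i \<in> I"
        show "\<psi> i \<in> V i"
        proof (cases "V i = A")
          case True
          then show ?thesis using PiE_mem[OF \<psi>(1) i] by simp
        next
          case False
          then show ?thesis using \<psi>(2)[OF i False] PiE_mem[OF V(2) i] by simp
        qed
      next
        fix i assume "i \<notin> I"
        then show "\<psi> i = undefined" by (rule PiE_arb[OF \<psi>(1)])
      qed
    qed
    then have "?D {i \<in> I. V i \<noteq> A} `` {\<phi>} \<subseteq> W" using V(3) by (rule order_trans)
    then show "\<exists>E\<in>\<U>. E `` {\<phi>} \<subseteq> W" using base[OF V(1)] by blast
  next
    assume W: "W \<subseteq> topspace X \<and> (\<forall>\<phi>\<in>W. \<exists>E\<in>\<U>. E `` {\<phi>} \<subseteq> W)"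
    show "openin X W"
    proof (subst openin_subopen, intro ballI)
      fix \<phi> assume \<phi>: "\<phi> \<in> W"
      then obtain E where E: "E \<in> \<U>" "E `` {\<phi>} \<subseteq> W" using W by meson
      obtain F where F: "finite F" "F \<subseteq> I" "?D F \<subseteq> E" using E(1) unfolding \<U>_def by blast
      have \<phi>X: "\<phi> \<in> PiE I (\<lambda>_. A)" using W \<phi> top by blast
      let ?V = "PiE I (\<lambda>i. if i \<in> F then {\<phi> i} else A)"
      have "finite {i \<in> I. (if i \<in> F then {\<phi> i} else A) \<noteq> A}"
        by (rule finite_subset[OF _ F(1)]) auto
      then have "openin X ?V"
        unfolding X_def openin_PiE_gen using \<phi>X by (auto simp: topspace_discrete_topology PiE_mem)
      moreover have "\<phi> \<in> ?V" using \<phi>X by (auto simp: PiE_iff)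
      moreover have "?V \<subseteq> W"
      proof
        fix \<psi> assume \<psi>: "\<psi> \<in> ?V"
        have 1: "\<phi> i = \<psi> i" if "i \<in> F" for i
          using PiE_mem[OF \<psi>, of i] that F(2) by auto
        have 2: "\<psi> i \<in> A" if "i \<in> I" for i
          using PiE_mem[OF \<psi> that] 1 PiE_mem[OF \<phi>X that] by (auto split: if_splits)
        have "\<psi> \<in> PiE I (\<lambda>_. A)" using 2 \<psi> by (auto simp: PiE_iff)
        then have "(\<phi>, \<psi>) \<in> ?D F" using \<phi>X 1 by (auto simp: top)
        then show "\<psi> \<in> W" using F(3) E(2) by blast
      qed
      ultimately show "\<exists>T. openin X T \<and> \<phi> \<in> T \<and> T \<subseteq> W" by blast
    qed
  qed
  ultimately have "compatible_uniformity X \<U>" unfolding compatible_uniformity_def by blast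
  then have "\<U> = diagonal_nbhds X" by (rule compatible_uniformity_unique[OF \<open>compact_space X\<close>])
  then show ?thesis using E unfolding \<U>_def by blast
qed

theorem flow_coset_flow:
  fixes G (structure)
  assumes TG: "topological_group G T" and H: "open_subgroup G T H"
  shows "flow G T (coset_cube G H) (coset_flow G H)"
proof -
  interpret group G using TG by (simp add: topological_group_def)
  have sub: "subgroup H G" and opH: "openin T H" using H by (simp_all add: open_subgroup_def)
  have HG: "H \<subseteq> carrier G" using sub by (rule subgroup.subset)
  have topT: "topspace T = carrier G"
    and cont: "continuous_map (prod_topology T T) T (\<lambda>(x, y). x \<otimes> y)"
    using TG by (simp_all add: topological_group_def)
  let ?X = "coset_cube G H" and ?I = "rcosets H" and ?\<alpha> = "coset_flow G H"
  have top: "topspace ?X = PiE ?I (\<lambda>_. {0, 1})" by (simp add: coset_cube_def)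
  have cpt: "compact_space ?X"
    by (simp add: coset_cube_def compact_space_product_topology compact_space_discrete_topology)
  have haus: "Hausdorff_space ?X"
    by (simp add: coset_cube_def Hausdorff_space_product_topology)
  have trI: "C #> g \<in> ?I" if "C \<in> ?I" "g \<in> carrier G" for C g
    using that HG by (auto simp: RCOSETS_def coset_mult_assoc)
  have tr2: "C #> g #> h = C #> (g \<otimes> h)" if "C \<in> ?I" "g \<in> carrier G" "h \<in> carrier G" for C g h
    using that HG rcosets_subset_PowG[OF sub] by (auto simp: coset_mult_assoc)
  have ap: "?\<alpha> g \<phi> C = \<phi> (C #> g)" if "\<phi> \<in> topspace ?X" "C \<in> ?I" for g \<phi> C
    using that by (simp add: coset_flow_def)
  have mem: "?\<alpha> g \<phi> \<in> topspace ?X" if "\<phi> \<in> topspace ?X" "g \<in> carrier G" for g \<phi>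
    unfolding top
  proof (rule PiE_I)
    fix C assume C: "C \<in> ?I"
    have "\<phi> \<in> PiE ?I (\<lambda>_. {0, 1})" using that(1) by (simp only: top)
    from PiE_mem[OF this trI[OF C that(2)]] show "?\<alpha> g \<phi> C \<in> {0, 1}"
      by (simp only: ap[OF that(1) C])
  qed (use that(1) in \<open>simp add: coset_flow_def\<close>)
  have eqI: "\<phi> = \<psi>" if "\<phi> \<in> topspace ?X" "\<psi> \<in> topspace ?X" "\<And>C. C \<in> ?I \<Longrightarrow> \<phi> C = \<psi> C" for \<phi> \<psi>
    using PiE_ext[of \<phi> ?I "\<lambda>_. {0, 1}" \<psi>] that unfolding top by blast
  have mult: "?\<alpha> (g \<otimes> h) \<phi> = ?\<alpha> g (?\<alpha> h \<phi>)"
    if "g \<in> carrier G" "h \<in> carrier G" "\<phi> \<in> topspace ?X" for g h \<phi>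
    by (rule eqI) (use that mem trI tr2 in \<open>simp_all add: ap\<close>)
  have one: "?\<alpha> \<one> \<phi> = \<phi>" if "\<phi> \<in> topspace ?X" for \<phi>
  proof (rule eqI)
    fix C assume "C \<in> ?I"
    then show "?\<alpha> \<one> \<phi> C = \<phi> C"
      using that rcosets_subset_PowG[OF sub] by (auto simp: ap coset_mult_one)
  qed (use that mem in auto)
  have con: "continuous_map ?X ?X (?\<alpha> g)" if g: "g \<in> carrier G" for g
  proof -
    have "continuous_map ?X (discrete_topology {0, 1}) (\<lambda>\<phi>. ?\<alpha> g \<phi> C)" if C: "C \<in> ?I" for C
    proof -
      have "continuous_map ?X (discrete_topology {0, 1}) (\<lambda>\<phi>. \<phi> (C #> g))"
        unfolding coset_cube_def by (rule continuous_map_product_projection[OF trI[OF C g]])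
      then show ?thesis by (rule continuous_map_eq) (simp add: ap C)
    qed
    moreover have "?\<alpha> g ` topspace ?X \<subseteq> extensional ?I"
      using mem g top by (fastforce simp: PiE_def)
    ultimately show ?thesis
      by (subst (2) coset_cube_def) (simp add: continuous_map_componentwise)
  qed
  have aut: "?\<alpha> g \<in> carrier (Aut ?X)" if g: "g \<in> carrier G" for g
  proof -
    have "homeomorphic_maps ?X ?X (?\<alpha> g) (?\<alpha> (inv g))"
      unfolding homeomorphic_maps_def
      using g con mult[of "inv g" g] mult[of g "inv g"] one by simp
    then have "homeomorphic_map ?X ?X (?\<alpha> g)" using homeomorphic_map_maps by blast
    then show ?thesis by (simp add: Aut_def coset_flow_def)
  qed
  have bij: "?\<alpha> g \<in> Bij (topspace ?X)" if "g \<in> carrier G" for g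
    using aut[OF that] by (auto simp: Aut_def Bij_def homeomorphic_eq_everything_map bij_betw_def)
  have "?\<alpha> \<in> hom G (Aut ?X)"
  proof (rule homI)
    fix g h assume gh: "g \<in> carrier G" "h \<in> carrier G"
    have "?\<alpha> (g \<otimes> h) = compose (topspace ?X) (?\<alpha> g) (?\<alpha> h)"
      using mult[OF gh] by (auto simp: compose_def coset_flow_def fun_eq_iff)
    then show "?\<alpha> (g \<otimes> h) = ?\<alpha> g \<otimes>\<^bsub>Aut ?X\<^esub> ?\<alpha> h"
      using bij gh by (simp add: Aut_def BijGroup_def)
  qed (rule aut)
  moreover have "continuous_map T (Aut_topology ?X) ?\<alpha>"
    unfolding continuous_map_def
  proof (intro conjI allI impI)
    have "openin (Aut_topology ?X) (carrier (Aut ?X))"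
    proof -
      have "is_uniformity (topspace ?X) (diagonal_nbhds ?X)"
        using compatible_uniformity_diagonal_nbhds[OF cpt haus]
        unfolding compatible_uniformity_def by (rule conjunct1)
      from is_uniformityD(1)[OF this] show ?thesis
        unfolding openin_Aut_topology[OF cpt haus] the_uniformity_eq[OF cpt haus] by blast
    qed
    then show "?\<alpha> \<in> topspace T \<rightarrow> topspace (Aut_topology ?X)"
      using aut openin_subset topT by blast
    fix W assume W: "openin (Aut_topology ?X) W"
    show "openin T {g \<in> topspace T. ?\<alpha> g \<in> W}"
    proof (subst openin_subopen, intro ballI)
      fix g assume "g \<in> {g \<in> topspace T. ?\<alpha> g \<in> W}"
      then have g: "g \<in> carrier G" "?\<alpha> g \<in> W" by (simp_all add: topT)
      then obtain E where E: "E \<in> diagonal_nbhds ?X"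
        "{f' \<in> carrier (Aut ?X). \<forall>x\<in>topspace ?X. (?\<alpha> g x, f' x) \<in> E} \<subseteq> W"
        using W unfolding openin_Aut_topology[OF cpt haus] the_uniformity_eq[OF cpt haus] by meson
      obtain F where F: "finite F" "F \<subseteq> ?I"
        "{(\<phi>, \<psi>) \<in> topspace ?X \<times> topspace ?X. \<forall>i\<in>F. \<phi> i = \<psi> i} \<subseteq> E"
        using diagonal_nbhds_cube[of "{0, 1::nat}" E ?I] E(1) unfolding coset_cube_def by auto
      have "\<exists>V. openin T V \<and> g \<in> V \<and> (\<forall>h\<in>V. C #> h = C #> g)" if "C \<in> F" for C
      proof -
        have "C \<in> ?I" using F(2) that by blast
        then obtain x where x: "x \<in> carrier G" "C = H #> x" by (auto simp: RCOSETS_def)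
        define k where "k = inv g \<otimes> inv x"
        have k: "k \<in> carrier G" using x g by (simp add: k_def)
        have "continuous_map T T (\<lambda>h. x \<otimes> h \<otimes> k)"
        proof -
          have "continuous_map T T (\<lambda>h. x \<otimes> h)"
            using continuous_map_compose[OF continuous_map_pairedI[of T T "\<lambda>_. x" T "\<lambda>h. h"] cont] x topT
            by (simp add: o_def)
          from continuous_map_compose[OF continuous_map_pairedI[OF this, of T "\<lambda>_. k"] cont] k topT
          show ?thesis by (simp add: o_def)
        qed
        then have "openin T {h \<in> topspace T. x \<otimes> h \<otimes> k \<in> H}"
          using opH by (rule openin_continuous_map_preimage)
        moreover have "x \<otimes> g \<otimes> k = \<one>"
          using x g by (simp add: k_def m_assoc inv_mult_group[symmetric])
        then have "g \<in> {h \<in> topspace T. x \<otimes> h \<otimes> k \<in> H}"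
          using g topT subgroup.one_closed[OF sub] by simp
        moreover have "C #> h = C #> g" if "h \<in> {h \<in> topspace T. x \<otimes> h \<otimes> k \<in> H}" for h
        proof -
          have h: "h \<in> carrier G" "x \<otimes> h \<otimes> k \<in> H" using that topT by auto
          have "(x \<otimes> h \<otimes> k) \<otimes> (x \<otimes> g) = x \<otimes> h"
            using x g h by (simp add: k_def inv_mult_group[symmetric] m_assoc inv_solve_right)
          moreover have "H #> ((x \<otimes> h \<otimes> k) \<otimes> (x \<otimes> g)) = H #> (x \<otimes> g)"
            using coset_mult_assoc[OF HG, of "x \<otimes> h \<otimes> k" "x \<otimes> g"] coset_join2[OF _ sub h(2)] x g h k
            by simp
          ultimately show ?thesis using x g h by (simp add: coset_mult_assoc[OF HG])
        qed
        ultimately show ?thesis by blast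
      qed
      then obtain V where V: "\<And>C. C \<in> F \<Longrightarrow> openin T (V C) \<and> g \<in> V C \<and> (\<forall>h\<in>V C. C #> h = C #> g)"
        by metis
      define O' where "O' = topspace T \<inter> \<Inter>(V ` F)"
      have "openin T O'"
        using F(1) V unfolding O'_def by (cases "F = {}") (auto intro!: openin_Int openin_INT)
      moreover have "g \<in> O'" using V g topT by (auto simp: O'_def)
      moreover have "?\<alpha> h \<in> W" if "h \<in> O'" for h
      proof -
        have h: "h \<in> carrier G" using that topT by (simp add: O'_def)
        have hC: "C #> h = C #> g" if "C \<in> F" for C
        proof -
          have "h \<in> V C" using \<open>h \<in> O'\<close> that by (simp add: O'_def)
          then show ?thesis using V[OF that] by blast
        qed
        have "(?\<alpha> g \<phi>, ?\<alpha> h \<phi>) \<in> E" if \<phi>: "\<phi> \<in> topspace ?X" for \<phi>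
        proof -
          have "?\<alpha> g \<phi> C = ?\<alpha> h \<phi> C" if "C \<in> F" for C
          proof -
            have "C \<in> ?I" using F(2) that by blast
            then show ?thesis by (simp add: ap[OF \<phi>] hC[OF that])
          qed
          then show ?thesis using F(3) mem[OF \<phi> g(1)] mem[OF \<phi> h] by blast
        qed
        then show ?thesis using E(2) aut[OF h] by blast
      qed
      moreover have "O' \<subseteq> topspace T" unfolding O'_def by (rule Int_lower1)
      ultimately show "\<exists>V. openin T V \<and> g \<in> V \<and> V \<subseteq> {g \<in> topspace T. ?\<alpha> g \<in> W}"
        by (intro exI[of _ O']) auto
    qed
  qed
  moreover have "topspace ?X \<noteq> {}" by (simp add: top PiE_eq_empty_iff)
  ultimately show ?thesis using cpt haus by (simp add: flow_def)
qed

end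

theory Submission
  imports Defs
begin

text \<open>If \<open>G\<close> is amenable, then every \<open>G\<close>-flow \<open>X\<close> is: composition with an orbit map \<open>g \<mapsto> \<alpha>(g) x\<^sub>0\<close> sends \<open>C(X)\<close>
  into \<open>UC\<^sub>b(G\<^sub>r)\<close> (\<open>orbit_function_UCb\<close>) and is compatible with the actions, so an invariant mean of the
  group induces one of the flow.

  For the converse, \<open>G\<close> acts on the compact convex set of all means on \<open>UC\<^sub>b(G\<^sub>r)\<close> by
  \<open>(g k)(f) = k(f \<circ> \<lambda>\<^sub>G(g))\<close>; let \<open>K\<close> be a minimal non-empty closed convex invariant subset.  If \<open>G\<close> is not
  amenable, \<open>K\<close> contains no fixed point, and some \<open>f\<close> has maximum \<open>M\<close> and minimum \<open>m\<close> on \<open>K\<close> with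
  \<open>d = M - m > 0\<close>.  Because \<open>G\<close> is non-archimedean, there is an open subgroup \<open>H\<close> such that \<open>f\<close> varies by
  at most \<open>d/3\<close> on each coset \<open>Hx\<close>.  Consider the \<open>\<phi> \<in> 2\<^bsup>H\G\<^esup>\<close> for which there is \<open>k \<in> K\<close> such that, for all \<open>g\<close>,
  \<open>(g k)(f) > M - d/3\<close> implies \<open>\<phi>(Hg) = 1\<close> and \<open>(g k)(f) < m + d/3\<close> implies \<open>\<phi>(Hg) = 0\<close>.  They form a
  non-empty closed invariant set, which contains a minimal subflow \<open>Y\<close>.

  Suppose \<open>Y\<close> carries an invariant mean.  It takes the same value \<open>c\<close> on all coordinate functions
  \<open>\<phi> \<mapsto> \<phi>(Hg)\<close>, and on any finite set of them it agrees with a convex combination of evaluations at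
  points \<open>y\<^sub>i\<close> of \<open>Y\<close> (\<open>amenable_flow_coset_values\<close>).  Each \<open>y\<^sub>i\<close> comes with some \<open>k\<^sub>i \<in> K\<close>; let \<open>b \<in> K\<close> be the
  combination of the \<open>k\<^sub>i\<close> with the same weights.  By minimality of \<open>K\<close>, some \<open>g\<close> moves \<open>b\<close> to a mean with
  \<open>(g b)(f) > M - d/9\<close>, and this \<open>g\<close> can be taken from a finite set that is independent of \<open>b\<close>
  (\<open>irreducible_orbits_reach\<close>).  As no \<open>(g k\<^sub>i)(f)\<close> exceeds \<open>M\<close>, those with \<open>(g k\<^sub>i)(f) \<le> M - d/3\<close> have total
  weight below \<open>1/3\<close>, so \<open>c > 2/3\<close>.  The same reasoning at the minimum gives \<open>c < 1/3\<close>.\<close>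


section \<open>Minimal closed sets\<close>

text \<open>Zorn's lemma: compactness keeps the intersection of a chain of non-empty closed sets non-empty.
  The property \<open>P\<close> will be invariance (for minimal subflows) and convexity with invariance (for
  irreducible sets of means).\<close>

lemma minimal_closed_set:
  assumes cpt: "compact_space X" and A: "closedin X A" "A \<noteq> {}" "P A"
    and Inter: "\<And>\<C>. \<C> \<noteq> {} \<Longrightarrow> (\<And>C. C \<in> \<C> \<Longrightarrow> P C) \<Longrightarrow> P (\<Inter>\<C>)"
  obtains B where "B \<subseteq> A" "closedin X B" "B \<noteq> {}" "P B"
    and "\<And>C. C \<subseteq> B \<Longrightarrow> closedin X C \<Longrightarrow> C \<noteq> {} \<Longrightarrow> P C \<Longrightarrow> C = B"
proof -
  define \<F> where "\<F> = {B. B \<subseteq> A \<and> closedin X B \<and> B \<noteq> {} \<and> P B}"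
  have "\<exists>B\<in>\<F>. \<forall>C\<in>\<F>. C \<subseteq> B \<longrightarrow> C = B"
  proof (rule predicate_Zorn)
    show "partial_order_on \<F> (relation_of (\<lambda>B C. C \<subseteq> B) \<F>)"
      by (rule partial_order_on_relation_ofI) auto
  next
    fix \<C> assume "\<C> \<in> Chains (relation_of (\<lambda>B C. C \<subseteq> B) \<F>)"
    then have sub: "\<C> \<subseteq> \<F>" and chain: "subset.chain \<F> \<C>"
      by (auto simp: Chains_def relation_of_def subset_chain_def)
    show "\<exists>B\<in>\<F>. \<forall>C\<in>\<C>. B \<subseteq> C"
    proof (cases "\<C> = {}")
      case True
      then show ?thesis using A by (auto simp: \<F>_def)
    next
      case False
      have "\<Inter>\<D> \<noteq> {}" if "finite \<D>" "\<D> \<subseteq> \<C>" for \<D>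
      proof (cases "\<D> = {}")
        case False
        have "subset.chain \<F> \<D>"
          using chain that unfolding subset_chain_def by (meson subset_iff)
        then have "\<Inter>\<D> \<in> \<D>" using that False by (intro Inter_in_chain)
        then show ?thesis using that sub by (auto simp: \<F>_def)
      qed simp
      moreover have "\<forall>C\<in>\<C>. closedin X C" using sub by (auto simp: \<F>_def)
      ultimately have "\<Inter>\<C> \<noteq> {}"
        by (intro cpt[unfolded compact_space_fip, rule_format]) simp_all
      moreover have "closedin X (\<Inter>\<C>)"
        using False sub by (intro closedin_Inter) (auto simp: \<F>_def)
      moreover have "\<Inter>\<C> \<subseteq> A" using False sub by (auto simp: \<F>_def)
      moreover have "P (\<Inter>\<C>)" using False sub by (intro Inter) (auto simp: \<F>_def)
      ultimately show ?thesis by (auto simp: \<F>_def)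
    qed
  qed
  then obtain B where "B \<in> \<F>" "\<And>C. C \<in> \<F> \<Longrightarrow> C \<subseteq> B \<Longrightarrow> C = B" by blast
  then show thesis by (intro that[of B]) (auto simp: \<F>_def)
qed


section \<open>Means\<close>

text \<open>What \<open>C(X)\<close> for compact \<open>X\<close> and \<open>UC\<^sub>b(G\<^sub>r)\<close> have in common and what the calculus of means
  rests on.\<close>

locale bounded_function_space =
  fixes S :: "'s set" and F :: "('s \<Rightarrow> real) set"
  assumes nonempty: "S \<noteq> {}"
    and extensional: "f \<in> F \<Longrightarrow> f \<in> extensional S"
    and bounded: "f \<in> F \<Longrightarrow> bounded (f ` S)"
    and const: "(\<lambda>x\<in>S. c) \<in> F"
    and add: "f \<in> F \<Longrightarrow> h \<in> F \<Longrightarrow> (\<lambda>x\<in>S. f x + h x) \<in> F"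
    and scale: "f \<in> F \<Longrightarrow> (\<lambda>x\<in>S. c * f x) \<in> F"
begin

lemma mean_add: "mean_on S F \<nu> \<Longrightarrow> f \<in> F \<Longrightarrow> h \<in> F \<Longrightarrow> \<nu> (\<lambda>x\<in>S. f x + h x) = \<nu> f + \<nu> h"
  by (simp add: mean_on_def)

lemma mean_scale: "mean_on S F \<nu> \<Longrightarrow> f \<in> F \<Longrightarrow> \<nu> (\<lambda>x\<in>S. c * f x) = c * \<nu> f"
  by (simp add: mean_on_def)

lemma mean_le:
  assumes "mean_on S F \<nu>" "f \<in> F" "\<And>x. x \<in> S \<Longrightarrow> f x \<le> c"
  shows "\<nu> f \<le> c"
proof -
  have "\<nu> f \<le> (SUP x\<in>S. f x)" using assms by (simp add: mean_on_def)
  also have "\<dots> \<le> c" using assms(3) nonempty by (rule cSUP_least[rotated])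
  finally show ?thesis .
qed

lemma mean_ge:
  assumes "mean_on S F \<nu>" "f \<in> F" "\<And>x. x \<in> S \<Longrightarrow> c \<le> f x"
  shows "c \<le> \<nu> f"
proof -
  have "c \<le> (INF x\<in>S. f x)" using assms(3) nonempty by (rule cINF_greatest[rotated])
  also have "\<dots> \<le> \<nu> f" using assms by (simp add: mean_on_def)
  finally show ?thesis .
qed

text \<open>The upper bound by the supremum is the lower bound for \<open>- f\<close>.\<close>

lemma mean_onI:
  assumes "\<And>f h. f \<in> F \<Longrightarrow> h \<in> F \<Longrightarrow> \<nu> (\<lambda>x\<in>S. f x + h x) = \<nu> f + \<nu> h"
    and "\<And>c f. f \<in> F \<Longrightarrow> \<nu> (\<lambda>x\<in>S. c * f x) = c * \<nu> f"
    and "\<And>c f. f \<in> F \<Longrightarrow> (\<And>x. x \<in> S \<Longrightarrow> c \<le> f x) \<Longrightarrow> c \<le> \<nu> f"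
  shows "mean_on S F \<nu>"
proof -
  have "(INF x\<in>S. f x) \<le> \<nu> f \<and> \<nu> f \<le> (SUP x\<in>S. f x)" if f: "f \<in> F" for f
  proof
    have bd: "bdd_below (f ` S)" "bdd_above (f ` S)"
      using bounded[OF f] by (rule bounded_imp_bdd_below, rule bounded_imp_bdd_above)
    show "(INF x\<in>S. f x) \<le> \<nu> f"
      by (rule assms(3)[OF f]) (rule cINF_lower[OF bd(1)])
    have "- (SUP x\<in>S. f x) \<le> \<nu> (\<lambda>x\<in>S. (-1) * f x)"
      by (rule assms(3)[OF scale[OF f]]) (simp add: cSUP_upper[OF _ bd(2)])
    then show "\<nu> f \<le> (SUP x\<in>S. f x)" unfolding assms(2)[OF f] by simp
  qed
  then show ?thesis using assms(1,2) by (simp add: mean_on_def)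
qed

lemma mean_close:
  assumes \<nu>: "mean_on S F \<nu>" and f: "f \<in> F" "h \<in> F" and le: "\<And>x. x \<in> S \<Longrightarrow> f x \<le> h x + \<epsilon>"
  shows "\<nu> f \<le> \<nu> h + \<epsilon>"
proof -
  have h': "(\<lambda>x\<in>S. (-1) * h x) \<in> F" using f by (intro scale)
  have "\<nu> (\<lambda>x\<in>S. f x + (\<lambda>x\<in>S. (-1) * h x) x) = \<nu> f + (-1) * \<nu> h"
    by (simp only: mean_add[OF \<nu> f(1) h'] mean_scale[OF \<nu> f(2)])
  moreover have "\<nu> (\<lambda>x\<in>S. f x + (\<lambda>x\<in>S. (-1) * h x) x) \<le> \<epsilon>"
    by (rule mean_le[OF \<nu> add[OF f(1) h']]) (use le in force)
  ultimately show ?thesis by simp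
qed

lemma sum_in:
  assumes "finite I" "\<And>i. i \<in> I \<Longrightarrow> f i \<in> F"
  shows "(\<lambda>x\<in>S. \<Sum>i\<in>I. c i * f i x) \<in> F"
  using assms
proof (induction I)
  case empty
  show ?case unfolding sum.empty by (rule const)
next
  case (insert i I)
  have "(\<lambda>x\<in>S. (\<lambda>x\<in>S. c i * f i x) x + (\<lambda>x\<in>S. \<Sum>i\<in>I. c i * f i x) x) \<in> F"
    using insert by (intro add scale) auto
  also have "(\<lambda>x\<in>S. (\<lambda>x\<in>S. c i * f i x) x + (\<lambda>x\<in>S. \<Sum>i\<in>I. c i * f i x) x)
      = (\<lambda>x\<in>S. \<Sum>i\<in>insert i I. c i * f i x)"
    using insert by (auto simp: fun_eq_iff)
  finally show ?case .
qed

lemma mean_sum: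
  assumes \<nu>: "mean_on S F \<nu>" and "finite I" "\<And>i. i \<in> I \<Longrightarrow> f i \<in> F"
  shows "\<nu> (\<lambda>x\<in>S. \<Sum>i\<in>I. c i * f i x) = (\<Sum>i\<in>I. c i * \<nu> (f i))"
  using assms(2,3)
proof (induction I)
  case empty
  have "\<nu> (\<lambda>x\<in>S. 0) = 0"
    using mean_le[OF \<nu> const[of 0], of 0] mean_ge[OF \<nu> const[of 0], of 0] by simp
  then show ?case by (simp only: sum.empty)
next
  case (insert i I)
  have eq: "(\<lambda>x\<in>S. \<Sum>i\<in>insert i I. c i * f i x)
      = (\<lambda>x\<in>S. (\<lambda>x\<in>S. c i * f i x) x + (\<lambda>x\<in>S. \<Sum>i\<in>I. c i * f i x) x)"
    using insert by (auto simp: fun_eq_iff)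
  have i: "f i \<in> F" and I: "(\<lambda>x\<in>S. \<Sum>i\<in>I. c i * f i x) \<in> F"
    using insert.prems insert.hyps by (auto intro: sum_in)
  have IH: "\<nu> (\<lambda>x\<in>S. \<Sum>i\<in>I. c i * f i x) = (\<Sum>i\<in>I. c i * \<nu> (f i))"
    using insert.prems by (intro insert.IH) auto
  show ?case
    unfolding eq mean_add[OF \<nu> scale[OF i] I] mean_scale[OF \<nu> i] IH
    by (simp only: sum.insert[OF insert.hyps])
qed

text \<open>For functions that factor through \<open>r\<close>, the mean \<open>\<nu>\<close> is integration against the masses
  \<open>t p = \<nu>(1\<^bsub>r = p\<^esub>)\<close> of the finitely many fibres.  A point \<open>y p\<close> chosen in each fibre turns this into a
  convex combination of point evaluations, without any extension of \<open>\<nu>\<close> to more functions.\<close>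

lemma mean_on_finite_partition:
  assumes \<nu>: "mean_on S F \<nu>" and fin: "finite (r ` S)"
    and ind: "\<And>p. p \<in> r ` S \<Longrightarrow> (\<lambda>x\<in>S. if r x = p then 1 else 0) \<in> F"
  obtains t y where "\<And>p. p \<in> r ` S \<Longrightarrow> 0 \<le> t p" "(\<Sum>p\<in>r ` S. t p) = 1"
    "\<And>p. p \<in> r ` S \<Longrightarrow> y p \<in> S" "\<And>p. p \<in> r ` S \<Longrightarrow> r (y p) = p"
    "\<And>h. \<nu> (\<lambda>x\<in>S. h (r x)) = (\<Sum>p\<in>r ` S. t p * h p)"
proof -
  let ?e = "\<lambda>p. \<lambda>x\<in>S. if r x = p then 1 else 0 :: real"
  have h: "\<nu> (\<lambda>x\<in>S. h (r x)) = (\<Sum>p\<in>r ` S. \<nu> (?e p) * h p)" for h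
  proof -
    have "(\<Sum>p\<in>r ` S. h p * ?e p x) = h (r x)" if "x \<in> S" for x
    proof -
      have "(\<Sum>p\<in>r ` S. h p * ?e p x) = (\<Sum>p\<in>r ` S. if p = r x then h p else 0)"
        using that by (intro sum.cong) auto
      then show ?thesis using fin that by simp
    qed
    then have "(\<lambda>x\<in>S. h (r x)) = (\<lambda>x\<in>S. \<Sum>p\<in>r ` S. h p * ?e p x)"
      by (intro restrict_ext) simp
    then show ?thesis using mean_sum[OF \<nu> fin, of ?e h] ind by (simp add: mult.commute)
  qed
  show thesis
  proof
    show "0 \<le> \<nu> (?e p)" if "p \<in> r ` S" for p
      by (rule mean_ge[OF \<nu> ind[OF that]]) auto
    have "\<nu> (\<lambda>x\<in>S. 1) = 1"
      using mean_le[OF \<nu> const[of 1], of 1] mean_ge[OF \<nu> const[of 1], of 1] by simp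
    then show "(\<Sum>p\<in>r ` S. \<nu> (?e p)) = 1" using h[of "\<lambda>_. 1"] by simp
    show "inv_into S r p \<in> S" "r (inv_into S r p) = p" if "p \<in> r ` S" for p
      using that by (auto intro: inv_into_into f_inv_into_f)
  qed (rule h)
qed

text \<open>Normalising the values outside \<open>F\<close> confines the means to a product of compact sets.\<close>

definition means :: "(('s \<Rightarrow> real) \<Rightarrow> real) set" where
  "means = {k \<in> extensional F. mean_on S F k}"

text \<open>Convexity in the space of functionals on \<open>F\<close>, with the operations taken pointwise on \<open>F\<close> and the
  value outside \<open>F\<close> normalised as in \<open>means\<close>.  Combinations of arbitrary finite length are part of the
  definition because barycentres of finitely supported measures are what it will be applied to.\<close>

definition convex_functionals :: "(('s \<Rightarrow> real) \<Rightarrow> real) set \<Rightarrow> bool" where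
  "convex_functionals C \<longleftrightarrow>
     (\<forall>n t k. (\<forall>i<n. 0 \<le> t i \<and> k i \<in> C) \<and> (\<Sum>i<n. t i) = 1 \<longrightarrow>
        (\<lambda>f\<in>F. \<Sum>i<n::nat. t i * k i f) \<in> C)"

lemma convex_functionalsD:
  assumes C: "convex_functionals C" and I: "finite I"
    and t: "\<And>i. i \<in> I \<Longrightarrow> 0 \<le> t i" "(\<Sum>i\<in>I. t i) = 1" and k: "\<And>i. i \<in> I \<Longrightarrow> k i \<in> C"
  shows "(\<lambda>f\<in>F. \<Sum>i\<in>I. t i * k i f) \<in> C"
proof -
  obtain b where b: "bij_betw b {..<card I} I"
    using ex_bij_betw_nat_finite[OF I] by (auto simp: atLeast0LessThan)
  have "(\<Sum>j<card I. t (b j)) = 1"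
    using sum.reindex_bij_betw[OF b, of t] t(2) by simp
  moreover have "\<forall>j<card I. 0 \<le> t (b j) \<and> k (b j) \<in> C"
    using b t(1) k by (auto simp: bij_betw_def)
  ultimately have "(\<lambda>f\<in>F. \<Sum>j<card I. t (b j) * k (b j) f) \<in> C"
    using C[unfolded convex_functionals_def, rule_format, of "card I" "\<lambda>j. t (b j)" "\<lambda>j. k (b j)"]
    by blast
  moreover have "(\<Sum>j<card I. t (b j) * k (b j) f) = (\<Sum>i\<in>I. t i * k i f)" for f
    by (rule sum.reindex_bij_betw[OF b])
  ultimately show ?thesis by simp
qed

lemma means_mean_on: "k \<in> means \<Longrightarrow> mean_on S F k"
  by (simp add: means_def)

lemma point_evaluation_means: "x \<in> S \<Longrightarrow> (\<lambda>f\<in>F. f x) \<in> means"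
  unfolding means_def by (auto intro!: mean_onI simp: add scale)

lemma convex_means: "convex_functionals means"
  unfolding convex_functionals_def
proof (intro allI impI)
  fix n and t :: "nat \<Rightarrow> real" and k :: "nat \<Rightarrow> ('s \<Rightarrow> real) \<Rightarrow> real"
  assume "(\<forall>i<n. 0 \<le> t i \<and> k i \<in> means) \<and> sum t {..<n} = 1"
  then have t: "\<And>i. i < n \<Longrightarrow> 0 \<le> t i" "sum t {..<n} = 1"
    and k: "\<And>i. i < n \<Longrightarrow> mean_on S F (k i)" by (auto simp: means_def)
  have "mean_on S F (\<lambda>f\<in>F. \<Sum>i<n. t i * k i f)"
  proof (rule mean_onI)
    fix f h assume "f \<in> F" "h \<in> F"
    then show "(\<lambda>f\<in>F. \<Sum>i<n. t i * k i f) (\<lambda>x\<in>S. f x + h x)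
        = (\<lambda>f\<in>F. \<Sum>i<n. t i * k i f) f + (\<lambda>f\<in>F. \<Sum>i<n. t i * k i f) h"
      using k by (simp add: add mean_add distrib_left sum.distrib)
  next
    fix c f assume "f \<in> F"
    then show "(\<lambda>f\<in>F. \<Sum>i<n. t i * k i f) (\<lambda>x\<in>S. c * f x) = c * (\<lambda>f\<in>F. \<Sum>i<n. t i * k i f) f"
      using k by (simp add: scale mean_scale sum_distrib_left mult.left_commute)
  next
    fix c f assume f: "f \<in> F" "\<And>x. x \<in> S \<Longrightarrow> c \<le> f x"
    have "c = (\<Sum>i<n. t i * c)" using t(2) by (simp add: sum_distrib_right[symmetric])
    also have "\<dots> \<le> (\<Sum>i<n. t i * k i f)"
      using t(1) k mean_ge f by (intro sum_mono mult_left_mono) auto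
    finally show "c \<le> (\<lambda>f\<in>F. \<Sum>i<n. t i * k i f) f" using f by simp
  qed
  then show "(\<lambda>f\<in>F. \<Sum>i<n. t i * k i f) \<in> means" by (simp add: means_def)
qed

text \<open>The argument of the Banach-Alaoglu theorem: the bounds confine a mean to a product of compact
  intervals, and linearity is a family of closed conditions on finitely many coordinates.\<close>

lemma compact_means: "compact means"
proof -
  define B where "B f = (if f \<in> F then {INF x\<in>S. f x..SUP x\<in>S. f x} else {undefined})" for f :: "'s \<Rightarrow> real"
  have "compactin (product_topology (\<lambda>_. euclidean) UNIV) (PiE UNIV B)"
    unfolding compactin_PiE by (auto simp: B_def)
  then have "compact (PiE UNIV B)"
    unfolding euclidean_product_topology by simp
  moreover have "closed {k. \<forall>f\<in>F. \<forall>h\<in>F. k (\<lambda>x\<in>S. f x + h x) = k f + (k h :: real)}"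
    unfolding Ball_def
    by (intro closed_Collect_all closed_Collect_imp closed_Collect_eq continuous_intros) simp_all
  moreover have "closed {k. \<forall>c. \<forall>f\<in>F. k (\<lambda>x\<in>S. c * f x) = c * (k f :: real)}"
    unfolding Ball_def
    by (intro closed_Collect_all closed_Collect_imp closed_Collect_eq continuous_intros) simp_all
  ultimately have "compact (PiE UNIV B
      \<inter> {k. \<forall>f\<in>F. \<forall>h\<in>F. k (\<lambda>x\<in>S. f x + h x) = k f + k h}
      \<inter> {k. \<forall>c. \<forall>f\<in>F. k (\<lambda>x\<in>S. c * f x) = c * k f})"
    by (intro compact_Int_closed)
  also have "PiE UNIV B
      \<inter> {k. \<forall>f\<in>F. \<forall>h\<in>F. k (\<lambda>x\<in>S. f x + h x) = k f + k h}
      \<inter> {k. \<forall>c. \<forall>f\<in>F. k (\<lambda>x\<in>S. c * f x) = c * k f} = means"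
  proof -
    have "k \<in> PiE UNIV B \<longleftrightarrow>
        k \<in> extensional F \<and> (\<forall>f\<in>F. (INF x\<in>S. f x) \<le> k f \<and> k f \<le> (SUP x\<in>S. f x))" for k
      by (auto simp: B_def PiE_iff extensional_def split: if_splits)
    then show ?thesis unfolding means_def mean_on_def by blast
  qed
  finally show ?thesis .
qed

end


section \<open>Flows\<close>

lemma topspace_Aut_topology:
  assumes "compact_space X" "Hausdorff_space X"
  shows "topspace (Aut_topology X) = carrier (Aut X)"
proof
  show "topspace (Aut_topology X) \<subseteq> carrier (Aut X)"
    using openin_Aut_topology[OF assms, of "topspace (Aut_topology X)"] by simp
  have "is_uniformity (topspace X) (the_uniformity X)"
    using compatible_uniformity_diagonal_nbhds[OF assms]
    by (simp add: the_uniformity_eq[OF assms] compatible_uniformity_def)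
  then have "openin (Aut_topology X) (carrier (Aut X))"
    unfolding openin_Aut_topology[OF assms] using is_uniformityD(1) by blast
  then show "carrier (Aut X) \<subseteq> topspace (Aut_topology X)" by (rule openin_subset)
qed

text \<open>A uniform ball around \<open>f\<close> need not be open; the points around which it still contains a uniform ball
  form the open set \<open>V\<close>, by the half-size axiom for entourages.\<close>

lemma uniform_nbhd_interior:
  assumes X: "compact_space X" "Hausdorff_space X"
    and E: "E \<in> diagonal_nbhds X" and f: "f \<in> carrier (Aut X)"
  obtains V where "openin (Aut_topology X) V" "f \<in> V"
    "\<And>f' x. f' \<in> V \<Longrightarrow> x \<in> topspace X \<Longrightarrow> (f x, f' x) \<in> E"
proof -
  let ?N = "\<lambda>f E. {f' \<in> carrier (Aut X). \<forall>x\<in>topspace X. (f x, f' x) \<in> E}"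
  have U: "is_uniformity (topspace X) (diagonal_nbhds X)"
    using compatible_uniformity_diagonal_nbhds[OF X] by (simp add: compatible_uniformity_def)
  define V where "V = {f' \<in> carrier (Aut X). \<exists>D\<in>diagonal_nbhds X. ?N f' D \<subseteq> ?N f E}"
  show thesis
  proof
    show "openin (Aut_topology X) V"
      unfolding openin_Aut_topology[OF X] the_uniformity_eq[OF X]
    proof (intro conjI ballI)
      show "V \<subseteq> carrier (Aut X)" by (auto simp: V_def)
      fix f' assume "f' \<in> V"
      then obtain D where D: "D \<in> diagonal_nbhds X" "?N f' D \<subseteq> ?N f E" unfolding V_def by blast
      obtain D' where D': "D' \<in> diagonal_nbhds X" "D' O D' \<subseteq> D"
        using is_uniformityD(7)[OF U D(1)] by blast
      have "?N f' D' \<subseteq> V"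
      proof
        fix f'' assume f'': "f'' \<in> ?N f' D'"
        have "?N f'' D' \<subseteq> ?N f' D"
        proof
          fix k assume "k \<in> ?N f'' D'"
          then have "k \<in> carrier (Aut X)" "\<forall>x\<in>topspace X. (f' x, k x) \<in> D' O D'"
            using f'' by blast+
          then show "k \<in> ?N f' D" using D'(2) by blast
        qed
        then have "?N f'' D' \<subseteq> ?N f E" using D(2) by (rule order_trans)
        then show "f'' \<in> V" using D'(1) f'' unfolding V_def by blast
      qed
      then show "\<exists>D\<in>diagonal_nbhds X. ?N f' D \<subseteq> V" using D'(1) by blast
    qed
    show "f \<in> V" using f E unfolding V_def by blast
    fix f' x assume f': "f' \<in> V" and x: "x \<in> topspace X"
    from f' obtain D where D: "D \<in> diagonal_nbhds X" "?N f' D \<subseteq> ?N f E" "f' \<in> carrier (Aut X)"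
      unfolding V_def by blast
    have "f' y \<in> topspace X" if "y \<in> topspace X" for y
      using D(3) that by (auto simp: Aut_def dest: homeomorphic_imp_surjective_map)
    then have "(f' y, f' y) \<in> D" if "y \<in> topspace X" for y
      using is_uniformityD(2)[OF U D(1)] that by blast
    then have "f' \<in> ?N f' D" using D(3) by blast
    then have "f' \<in> ?N f E" using D(2) by (rule subsetD[rotated])
    then show "(f x, f' x) \<in> E" using x by blast
  qed
qed

text \<open>Entourages suffice to express continuity into the automorphism group; in this form continuity
  passes to subflows and can be combined with uniformly continuous functions.\<close>

lemma continuous_map_Aut_topology:
  assumes X: "compact_space X" "Hausdorff_space X"
  shows "continuous_map T (Aut_topology X) \<alpha> \<longleftrightarrow>
    (\<forall>g\<in>topspace T. \<alpha> g \<in> carrier (Aut X)) \<and>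
    (\<forall>g\<in>topspace T. \<forall>E\<in>diagonal_nbhds X. \<exists>V. openin T V \<and> g \<in> V \<and>
       (\<forall>h\<in>V. \<forall>x\<in>topspace X. (\<alpha> g x, \<alpha> h x) \<in> E))"
    (is "?L \<longleftrightarrow> ?A \<and> ?R")
proof (intro iffI conjI)
  assume L: ?L
  then show A: ?A using topspace_Aut_topology[OF X] by (auto simp: continuous_map_def)
  show ?R
  proof (intro ballI)
    fix g E assume g: "g \<in> topspace T" and E: "E \<in> diagonal_nbhds X"
    have "\<alpha> g \<in> carrier (Aut X)" using A g by blast
    then obtain V where V: "openin (Aut_topology X) V" "\<alpha> g \<in> V"
      "\<And>f' x. f' \<in> V \<Longrightarrow> x \<in> topspace X \<Longrightarrow> (\<alpha> g x, f' x) \<in> E"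
      using uniform_nbhd_interior[OF X E] by metis
    have "openin T {h \<in> topspace T. \<alpha> h \<in> V}"
      by (rule openin_continuous_map_preimage[OF L V(1)])
    then show "\<exists>V. openin T V \<and> g \<in> V \<and> (\<forall>h\<in>V. \<forall>x\<in>topspace X. (\<alpha> g x, \<alpha> h x) \<in> E)"
      using V(2,3) g by (intro exI[of _ "{h \<in> topspace T. \<alpha> h \<in> V}"]) auto
  qed
next
  assume "?A \<and> ?R"
  then have A: ?A and R: ?R by auto
  show ?L
    unfolding continuous_map_def
  proof (intro conjI allI impI)
    show "\<alpha> \<in> topspace T \<rightarrow> topspace (Aut_topology X)" using A topspace_Aut_topology[OF X] by auto
    fix W assume W: "openin (Aut_topology X) W"
    show "openin T {g \<in> topspace T. \<alpha> g \<in> W}"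
    proof (subst openin_subopen, intro ballI)
      fix g assume g: "g \<in> {g \<in> topspace T. \<alpha> g \<in> W}"
      then obtain E where E: "E \<in> diagonal_nbhds X"
        "{f' \<in> carrier (Aut X). \<forall>x\<in>topspace X. (\<alpha> g x, f' x) \<in> E} \<subseteq> W"
        using W unfolding openin_Aut_topology[OF X] the_uniformity_eq[OF X] by auto
      obtain V where V: "openin T V" "g \<in> V" "\<And>h x. h \<in> V \<Longrightarrow> x \<in> topspace X \<Longrightarrow> (\<alpha> g x, \<alpha> h x) \<in> E"
        using R g E(1) by (metis (no_types, lifting) mem_Collect_eq)
      have "\<alpha> h \<in> W" "h \<in> topspace T" if "h \<in> V" for h
      proof -
        show "h \<in> topspace T" using openin_subset[OF V(1)] that by blast
        then have "\<alpha> h \<in> carrier (Aut X)" using A by blast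
        then show "\<alpha> h \<in> W" using V(3)[OF that] E(2) by blast
      qed
      then have "V \<subseteq> {g \<in> topspace T. \<alpha> g \<in> W}" by blast
      then show "\<exists>V. openin T V \<and> g \<in> V \<and> V \<subseteq> {g \<in> topspace T. \<alpha> g \<in> W}" using V by blast
    qed
  qed
qed

lemma Aut_mult:
  assumes "f \<in> carrier (Aut X)" "h \<in> carrier (Aut X)"
  shows "f \<otimes>\<^bsub>Aut X\<^esub> h = compose (topspace X) f h"
proof -
  have "f \<in> Bij (topspace X)" "h \<in> Bij (topspace X)"
    using assms by (auto simp: Aut_def Bij_def homeomorphic_eq_everything_map bij_betw_def)
  then show ?thesis by (simp add: Aut_def BijGroup_def)
qed

lemma flowD:
  assumes "flow G T X \<alpha>"
  shows "topspace X \<noteq> {}" "compact_space X" "Hausdorff_space X"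
    and "g \<in> carrier G \<Longrightarrow> \<alpha> g \<in> carrier (Aut X)"
    and "g \<in> carrier G \<Longrightarrow> continuous_map X X (\<alpha> g)"
    and "g \<in> carrier G \<Longrightarrow> x \<in> topspace X \<Longrightarrow> \<alpha> g x \<in> topspace X"
    and "g \<in> carrier G \<Longrightarrow> h \<in> carrier G \<Longrightarrow> x \<in> topspace X \<Longrightarrow> \<alpha> (g \<otimes>\<^bsub>G\<^esub> h) x = \<alpha> g (\<alpha> h x)"
proof -
  show "topspace X \<noteq> {}" "compact_space X" "Hausdorff_space X"
    using assms by (auto simp: flow_def)
  have hom: "\<alpha> \<in> hom G (Aut X)" using assms by (simp add: flow_def)
  show aut: "\<alpha> g \<in> carrier (Aut X)" if "g \<in> carrier G" for g
    using hom that by (rule hom_in_carrier)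
  show con: "continuous_map X X (\<alpha> g)" if "g \<in> carrier G" for g
    using aut[OF that] by (auto simp: Aut_def homeomorphic_imp_continuous_map)
  show "\<alpha> g x \<in> topspace X" if "g \<in> carrier G" "x \<in> topspace X" for g x
    using con[OF that(1)] that(2) by (auto simp: continuous_map_def)
  show "\<alpha> (g \<otimes>\<^bsub>G\<^esub> h) x = \<alpha> g (\<alpha> h x)"
    if "g \<in> carrier G" "h \<in> carrier G" "x \<in> topspace X" for g h x
    using hom_mult[OF hom that(1,2)] Aut_mult[OF aut aut] that by (simp add: compose_def)
qed

lemma flow_uniform_nbhd:
  assumes \<alpha>: "flow G T X \<alpha>" and g: "g \<in> topspace T" and E: "E \<in> diagonal_nbhds X"
  obtains V where "openin T V" "g \<in> V" "\<And>h x. h \<in> V \<Longrightarrow> x \<in> topspace X \<Longrightarrow> (\<alpha> g x, \<alpha> h x) \<in> E"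
proof -
  have "continuous_map T (Aut_topology X) \<alpha>" using \<alpha> by (simp add: flow_def)
  then have "\<forall>g\<in>topspace T. \<forall>E\<in>diagonal_nbhds X. \<exists>V. openin T V \<and> g \<in> V \<and>
      (\<forall>h\<in>V. \<forall>x\<in>topspace X. (\<alpha> g x, \<alpha> h x) \<in> E)"
    unfolding continuous_map_Aut_topology[OF flowD(2,3)[OF \<alpha>]] by (rule conjunct2)
  from this[rule_format, OF g E] show thesis using that by blast
qed

lemma flow_one:
  assumes "group G" and \<alpha>: "flow G T X \<alpha>" and x: "x \<in> topspace X"
  shows "\<alpha> \<one>\<^bsub>G\<^esub> x = x"
proof -
  interpret group G by fact
  have "\<alpha> \<one>\<^bsub>G\<^esub> (\<alpha> \<one>\<^bsub>G\<^esub> x) = \<alpha> \<one>\<^bsub>G\<^esub> x"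
    using flowD(7)[OF \<alpha> one_closed one_closed x] by simp
  moreover have "inj_on (\<alpha> \<one>\<^bsub>G\<^esub>) (topspace X)"
    using flowD(4)[OF \<alpha> one_closed] by (auto simp: Aut_def homeomorphic_eq_everything_map)
  ultimately show ?thesis using x flowD(6)[OF \<alpha> one_closed] by (meson inj_onD)
qed

text \<open>Forward invariance under all \<open>g\<close> is invariance, because \<open>g\<close> and its inverse both act.  Unlike the
  equality \<open>\<alpha> g ` Y = Y\<close>, it visibly passes to intersections, as Zorn's lemma requires.\<close>

lemma flow_invariantI:
  assumes G: "group G" and \<alpha>: "flow G T X \<alpha>" and Y: "Y \<subseteq> topspace X"
    and inv: "\<And>g y. g \<in> carrier G \<Longrightarrow> y \<in> Y \<Longrightarrow> \<alpha> g y \<in> Y"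
  shows "flow_invariant G \<alpha> Y"
  unfolding flow_invariant_def
proof (intro ballI equalityI subsetI)
  interpret group G by fact
  fix g y assume g: "g \<in> carrier G"
  show "y \<in> Y" if "y \<in> \<alpha> g ` Y" using that inv g by auto
  assume y: "y \<in> Y"
  have "\<alpha> g (\<alpha> (inv\<^bsub>G\<^esub> g) y) = y"
    using flowD(7)[OF \<alpha> g inv_closed[OF g], of y] flow_one[OF G \<alpha>, of y] Y y g by auto
  then show "y \<in> \<alpha> g ` Y" using inv[OF inv_closed[OF g] y] by (metis imageI)
qed

text \<open>An open neighbourhood of the diagonal of \<open>Y\<close> becomes one of the diagonal of \<open>X\<close> after adding all
  pairs outside \<open>Y \<times> Y\<close>, which is an open set since \<open>Y\<close> is closed.\<close>

lemma diagonal_nbhds_subtopology: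
  assumes Y: "closedin X Y" and E: "E \<in> diagonal_nbhds (subtopology X Y)"
  obtains D where "D \<in> diagonal_nbhds X" "D \<inter> Y \<times> Y \<subseteq> E"
proof -
  have YX: "Y \<subseteq> topspace X" using Y by (rule closedin_subset)
  then have top: "topspace (subtopology X Y) = Y" by auto
  obtain W where W: "openin (prod_topology (subtopology X Y) (subtopology X Y)) W"
    "Id_on Y \<subseteq> W" "W \<subseteq> E"
    using E unfolding diagonal_nbhds_def top by blast
  obtain W' where W': "openin (prod_topology X X) W'" "W = W' \<inter> Y \<times> Y"
    using W(1) unfolding subtopology_Times[symmetric] openin_subtopology by blast
  define D where "D = W' \<union> (topspace X \<times> topspace X - Y \<times> Y)"
  have "closedin (prod_topology X X) (Y \<times> Y)" using Y by (simp add: closedin_prod_Times_iff)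
  then have "openin (prod_topology X X) D"
    using W'(1) unfolding D_def by (metis openin_Un openin_diff openin_topspace topspace_prod_topology)
  moreover have "D \<subseteq> topspace X \<times> topspace X"
    using openin_subset[OF W'(1)] by (auto simp: D_def)
  moreover have "Id_on (topspace X) \<subseteq> D"
    using W(2) W'(2) by (auto simp: D_def)
  ultimately have "D \<in> diagonal_nbhds X" unfolding diagonal_nbhds_def by blast
  moreover have "D \<inter> Y \<times> Y \<subseteq> E" using W(3) W'(2) by (auto simp: D_def)
  ultimately show thesis by (rule that)
qed

lemma subflow_restrict:
  assumes TG: "topological_group G T" and \<alpha>: "flow G T X \<alpha>"
    and Y: "closedin X Y" "Y \<noteq> {}" and inv: "flow_invariant G \<alpha> Y"
  shows "subflow G T X \<alpha> Y (\<lambda>g. restrict (\<alpha> g) Y)"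
proof -
  have topT: "topspace T = carrier G" using TG by (simp add: topological_group_def)
  interpret group G using TG by (simp add: topological_group_def)
  let ?Y = "subtopology X Y" and ?\<beta> = "\<lambda>g. restrict (\<alpha> g) Y"
  have YX: "Y \<subseteq> topspace X" using Y(1) by (rule closedin_subset)
  then have top: "topspace ?Y = Y" by auto
  note X = flowD(2,3)[OF \<alpha>]
  have YC: "compact_space ?Y" "Hausdorff_space ?Y"
    using X Y(1) by (auto intro: compact_space_subtopology closedin_compact_space
        Hausdorff_space_subtopology)
  have aut: "?\<beta> g \<in> carrier (Aut ?Y)" if g: "g \<in> carrier G" for g
  proof -
    have "homeomorphic_map X X (\<alpha> g)" using flowD(4)[OF \<alpha> g] by (simp add: Aut_def)
    moreover have "\<alpha> g ` (topspace X \<inter> Y) = topspace X \<inter> Y"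
      using inv g YX by (simp add: flow_invariant_def Int_absorb1)
    ultimately have "homeomorphic_map ?Y ?Y (\<alpha> g)" by (rule homeomorphic_map_subtopologies)
    then have "homeomorphic_map ?Y ?Y (?\<beta> g)"
      by (rule homeomorphic_map_eq) (simp add: top)
    then show ?thesis by (simp add: Aut_def Int_absorb1[OF YX])
  qed
  have memY: "\<alpha> g y \<in> Y" if "g \<in> carrier G" "y \<in> Y" for g y
    using inv that unfolding flow_invariant_def by blast
  have "?\<beta> \<in> hom G (Aut ?Y)"
  proof (rule homI)
    fix g h assume gh: "g \<in> carrier G" "h \<in> carrier G"
    have "?\<beta> (g \<otimes>\<^bsub>G\<^esub> h) = compose Y (?\<beta> g) (?\<beta> h)"
      using flowD(7)[OF \<alpha> gh] YX memY[OF gh(2)] by (auto simp: compose_def fun_eq_iff)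
    then show "?\<beta> (g \<otimes>\<^bsub>G\<^esub> h) = ?\<beta> g \<otimes>\<^bsub>Aut ?Y\<^esub> ?\<beta> h"
      by (simp add: Aut_mult[OF aut aut] gh Int_absorb1[OF YX])
  qed (rule aut)
  moreover have "continuous_map T (Aut_topology ?Y) ?\<beta>"
    unfolding continuous_map_Aut_topology[OF YC] topT top
  proof (intro conjI ballI)
    fix g E assume g: "g \<in> carrier G" and E: "E \<in> diagonal_nbhds ?Y"
    obtain D where D: "D \<in> diagonal_nbhds X" "D \<inter> Y \<times> Y \<subseteq> E"
      using diagonal_nbhds_subtopology[OF Y(1) E] by metis
    obtain V where V: "openin T V" "g \<in> V"
      "\<And>h x. h \<in> V \<Longrightarrow> x \<in> topspace X \<Longrightarrow> (\<alpha> g x, \<alpha> h x) \<in> D"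
      using flow_uniform_nbhd[OF \<alpha> _ D(1), of g] g topT by metis
    have "(?\<beta> g y, ?\<beta> h y) \<in> E" if "h \<in> V" "y \<in> Y" for h y
    proof -
      have "h \<in> carrier G" using openin_subset[OF V(1)] that(1) topT by auto
      then have "(\<alpha> g y, \<alpha> h y) \<in> D \<inter> Y \<times> Y"
        using V(3)[OF that(1), of y] that(2) memY g YX by blast
      then show ?thesis using D(2) that(2) by auto
    qed
    then show "\<exists>V. openin T V \<and> g \<in> V \<and> (\<forall>h\<in>V. \<forall>y\<in>Y. (?\<beta> g y, ?\<beta> h y) \<in> E)"
      using V(1,2) by blast
  qed (rule aut)
  ultimately have "flow G T ?Y ?\<beta>" using YC Y(2) top unfolding flow_def by blast
  then show ?thesis using Y inv unfolding subflow_def by blast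
qed

lemma ex_minimal_subflow:
  assumes TG: "topological_group G T" and \<alpha>: "flow G T X \<alpha>"
    and A: "closedin X A" "A \<noteq> {}" and inv: "\<And>g y. g \<in> carrier G \<Longrightarrow> y \<in> A \<Longrightarrow> \<alpha> g y \<in> A"
  obtains Y where "Y \<subseteq> A" "subflow G T X \<alpha> Y (\<lambda>g. restrict (\<alpha> g) Y)"
    "minimal_flow G T (subtopology X Y) (\<lambda>g. restrict (\<alpha> g) Y)"
proof -
  have G: "group G" using TG by (simp add: topological_group_def)
  define P where "P B \<longleftrightarrow> (\<forall>g\<in>carrier G. \<forall>y\<in>B. \<alpha> g y \<in> B)" for B
  obtain Y where Y: "Y \<subseteq> A" "closedin X Y" "Y \<noteq> {}" "P Y"
    and min: "\<And>C. C \<subseteq> Y \<Longrightarrow> closedin X C \<Longrightarrow> C \<noteq> {} \<Longrightarrow> P C \<Longrightarrow> C = Y"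
    by (rule minimal_closed_set[OF flowD(2)[OF \<alpha>] A, of P]) (use inv in \<open>auto simp: P_def\<close>)
  have YX: "Y \<subseteq> topspace X" using Y(2) by (rule closedin_subset)
  have "flow_invariant G \<alpha> Y"
    using Y(4) by (intro flow_invariantI[OF G \<alpha> YX]) (auto simp: P_def)
  then have sub: "subflow G T X \<alpha> Y (\<lambda>g. restrict (\<alpha> g) Y)"
    by (rule subflow_restrict[OF TG \<alpha> Y(2,3)])
  have "C = {} \<or> C = topspace (subtopology X Y)"
    if C: "closedin (subtopology X Y) C" "flow_invariant G (\<lambda>g. restrict (\<alpha> g) Y) C" for C
  proof (cases "C = {}")
    case False
    have CY: "C \<subseteq> Y" and CX: "closedin X C"
      using C(1) closedin_closed_subtopology[OF Y(2)] by auto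
    have "P C"
      unfolding P_def
    proof (intro ballI)
      fix g y assume gy: "g \<in> carrier G" "y \<in> C"
      then have "restrict (\<alpha> g) Y y \<in> C" using C(2) unfolding flow_invariant_def by blast
      then show "\<alpha> g y \<in> C" using gy CY by auto
    qed
    then show ?thesis using min[OF CY CX False] YX by auto
  qed simp
  then have "minimal_flow G T (subtopology X Y) (\<lambda>g. restrict (\<alpha> g) Y)"
    using sub unfolding minimal_flow_def subflow_def by blast
  then show thesis using that Y(1) sub by blast
qed


section \<open>Function spaces of flows and groups\<close>

lemma continuous_functions_space:
  assumes cpt: "compact_space X" and ne: "topspace X \<noteq> {}"
  shows "bounded_function_space (topspace X) (continuous_functions X)"
proof
  show "topspace X \<noteq> {}" by (rule ne)
  fix f assume f: "f \<in> continuous_functions X"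
  then show "f \<in> extensional (topspace X)" by (simp add: continuous_functions_def)
  have "compactin euclideanreal (f ` topspace X)"
    using cpt f unfolding continuous_functions_def compact_space_def
    by (blast intro: image_compactin)
  then show "bounded (f ` topspace X)" by (simp add: compact_imp_bounded)
  show "(\<lambda>x\<in>topspace X. c * f x) \<in> continuous_functions X" for c
  proof -
    have "continuous_map X euclideanreal (\<lambda>x. c * f x)"
      using f by (auto simp: continuous_functions_def intro: continuous_map_real_mult_left)
    then have "continuous_map X euclideanreal (\<lambda>x\<in>topspace X. c * f x)"
      by (rule continuous_map_eq) simp
    then show ?thesis by (simp add: continuous_functions_def)
  qed
  fix h assume h: "h \<in> continuous_functions X"
  have "continuous_map X euclideanreal (\<lambda>x. f x + h x)"
    using f h by (auto simp: continuous_functions_def intro: continuous_map_add)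
  then have "continuous_map X euclideanreal (\<lambda>x\<in>topspace X. f x + h x)"
    by (rule continuous_map_eq) simp
  then show "(\<lambda>x\<in>topspace X. f x + h x) \<in> continuous_functions X"
    by (simp add: continuous_functions_def)
next
  fix c :: real
  have "continuous_map X euclideanreal (\<lambda>x\<in>topspace X. c)"
    by (rule continuous_map_eq[of X _ "\<lambda>_. c"]) auto
  then show "(\<lambda>x\<in>topspace X. c) \<in> continuous_functions X"
    by (simp add: continuous_functions_def)
qed

text \<open>The restriction of a point to the finite set \<open>J\<close> of coordinates takes finitely many values on
  clopen fibres, so \<open>mean_on_finite_partition\<close> applies to it.\<close>

lemma mean_on_cube_coordinates:
  fixes I :: "'i set" and A :: "nat set" and Y :: "('i \<Rightarrow> nat) set"
  defines "X \<equiv> subtopology (product_topology (\<lambda>_. discrete_topology A) I) Y"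
  assumes A: "finite A" and Y: "closedin (product_topology (\<lambda>_. discrete_topology A) I) Y" "Y \<noteq> {}"
    and \<nu>: "mean_on Y (continuous_functions X) \<nu>" and J: "finite J" "J \<subseteq> I"
  obtains R :: "('i \<Rightarrow> nat) set" and t y where "finite R" "\<And>p. p \<in> R \<Longrightarrow> 0 \<le> t p" "(\<Sum>p\<in>R. t p) = 1"
    "\<And>p. p \<in> R \<Longrightarrow> y p \<in> Y"
    "\<And>i. i \<in> J \<Longrightarrow> \<nu> (\<lambda>\<phi>\<in>Y. real (\<phi> i)) = (\<Sum>p\<in>R. t p * real (y p i :: nat))"
proof -
  let ?r = "\<lambda>\<phi>. restrict \<phi> J"
  have YP: "Y \<subseteq> PiE I (\<lambda>_. A)" using closedin_subset[OF Y(1)] by simp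
  then have top: "topspace X = Y" by (auto simp: X_def)
  have "compact_space (product_topology (\<lambda>_. discrete_topology A) I)"
    using A by (simp add: compact_space_product_topology compact_space_discrete_topology)
  then have cpt: "compact_space X"
    unfolding X_def using Y(1) by (intro compact_space_subtopology closedin_compact_space)
  interpret bounded_function_space Y "continuous_functions X"
    using continuous_functions_space[OF cpt] Y(2) top by simp
  have fin: "finite (?r ` Y)"
  proof (rule finite_subset)
    show "?r ` Y \<subseteq> PiE J (\<lambda>_. A)" using YP J(2) by (auto simp: PiE_iff subset_iff)
    show "finite (PiE J (\<lambda>_. A))" using A J(1) by (simp add: finite_PiE)
  qed
  have ind: "(\<lambda>\<phi>\<in>Y. if ?r \<phi> = p then 1 else 0) \<in> continuous_functions X" if p: "p \<in> ?r ` Y" for p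
  proof -
    have "continuous_map X euclideanreal (\<lambda>\<phi>. if \<phi> i = p i then 1 else 0)" if "i \<in> J" for i
    proof -
      have "continuous_map X (discrete_topology A) (\<lambda>\<phi>. \<phi> i)"
        unfolding X_def using that J(2)
        by (intro continuous_map_from_subtopology continuous_map_product_projection) auto
      moreover have "continuous_map (discrete_topology A) euclideanreal (\<lambda>a. if a = p i then 1 else 0)"
        by simp
      ultimately have "continuous_map X euclideanreal ((\<lambda>a. if a = p i then 1 else 0) \<circ> (\<lambda>\<phi>. \<phi> i))"
        by (rule continuous_map_compose)
      then show ?thesis by (simp add: o_def)
    qed
    then have "continuous_map X euclideanreal (\<lambda>\<phi>. \<Prod>i\<in>J. if \<phi> i = p i then 1 else 0)"
      using J(1) by (intro continuous_map_prod) auto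
    moreover have "(\<Prod>i\<in>J. if \<phi> i = p i then 1 else 0) = (if ?r \<phi> = p then 1 else 0 :: real)" for \<phi>
    proof (cases "\<forall>i\<in>J. \<phi> i = p i")
      case True
      moreover have "?r \<phi> = p"
        using True p by (auto simp: fun_eq_iff restrict_def)
      ultimately show ?thesis by simp
    next
      case False
      then have "(\<Prod>i\<in>J. if \<phi> i = p i then 1 else 0 :: real) = 0"
        using J(1) by (intro prod_zero) auto
      moreover have "?r \<phi> \<noteq> p" using False by (auto simp: fun_eq_iff restrict_def)
      ultimately show ?thesis by simp
    qed
    ultimately have "continuous_map X euclideanreal (\<lambda>\<phi>. if ?r \<phi> = p then 1 else 0)" by simp
    then have "continuous_map X euclideanreal (\<lambda>\<phi>\<in>Y. if ?r \<phi> = p then 1 else 0)"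
      by (rule continuous_map_eq) (simp add: top)
    then show ?thesis by (simp add: continuous_functions_def top)
  qed
  show thesis
  proof (rule mean_on_finite_partition[OF \<nu> fin ind], assumption)
    fix t y
    assume t: "\<And>p. p \<in> ?r ` Y \<Longrightarrow> 0 \<le> t p" "(\<Sum>p\<in>?r ` Y. t p) = 1"
      and y: "\<And>p. p \<in> ?r ` Y \<Longrightarrow> y p \<in> Y" "\<And>p. p \<in> ?r ` Y \<Longrightarrow> ?r (y p) = p"
      and h: "\<And>h. \<nu> (\<lambda>\<phi>\<in>Y. h (?r \<phi>)) = (\<Sum>p\<in>?r ` Y. t p * h p)"
    show thesis
    proof (rule that[of "?r ` Y" t y])
      fix i assume i: "i \<in> J"
      have "(\<lambda>\<phi>\<in>Y. real (\<phi> i)) = (\<lambda>\<phi>\<in>Y. real (?r \<phi> i))" using i by auto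
      then have "\<nu> (\<lambda>\<phi>\<in>Y. real (\<phi> i)) = (\<Sum>p\<in>?r ` Y. t p * real (p i))"
        using h[of "\<lambda>p. real (p i)"] by simp
      also have "\<dots> = (\<Sum>p\<in>?r ` Y. t p * real (y p i))"
      proof (rule sum.cong[OF refl])
        fix p assume "p \<in> ?r ` Y"
        then have "p i = ?r (y p) i" by (simp only: y(2))
        then show "t p * real (p i) = t p * real (y p i)" using i by simp
      qed
      finally show "\<nu> (\<lambda>\<phi>\<in>Y. real (\<phi> i)) = (\<Sum>p\<in>?r ` Y. t p * real (y p i))" .
    qed (use fin t y in simp_all)
  qed
qed

lemma closedin_snd_image:
  assumes "compact_space X" "compact_space Y" "Hausdorff_space Y" "closedin (prod_topology X Y) Z"
  shows "closedin Y (snd ` Z)"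
proof -
  have "compactin (prod_topology X Y) Z"
    using assms by (simp add: closedin_compact_space compact_space_prod_topology)
  then have "compactin Y (snd ` Z)" using continuous_map_snd by (rule image_compactin)
  then show ?thesis using assms(3) by (intro compactin_imp_closedin)
qed

locale topological_grp = group G for G (structure) +
  fixes T :: "'a topology"
  assumes topological: "topological_group G T"
begin

lemma topspace_eq: "topspace T = carrier G"
  using topological by (simp add: topological_group_def)

lemma continuous_mult_left: "g \<in> carrier G \<Longrightarrow> continuous_map T T (\<lambda>x. g \<otimes> x)"
  and continuous_mult_right: "g \<in> carrier G \<Longrightarrow> continuous_map T T (\<lambda>x. x \<otimes> g)"
proof -
  have m: "continuous_map (prod_topology T T) T (\<lambda>(x, y). x \<otimes> y)"
    using topological by (simp add: topological_group_def)
  assume g: "g \<in> carrier G"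
  show "continuous_map T T (\<lambda>x. g \<otimes> x)"
    using continuous_map_compose[OF continuous_map_pairedI[of T T "\<lambda>_. g" T "\<lambda>x. x"] m] g
    by (simp add: o_def topspace_eq)
  show "continuous_map T T (\<lambda>x. x \<otimes> g)"
    using continuous_map_compose[OF continuous_map_pairedI[of T T "\<lambda>x. x" T "\<lambda>_. g"] m] g
    by (simp add: o_def topspace_eq)
qed

lemma identity_nbhd_carrier: "identity_nbhd G T (carrier G)"
  unfolding identity_nbhd_def
  by (intro conjI subset_refl exI[of _ "carrier G"]) (simp_all flip: topspace_eq, simp add: topspace_eq)

lemma identity_nbhd_Int:
  assumes "identity_nbhd G T U" "identity_nbhd G T V"
  shows "identity_nbhd G T (U \<inter> V)"
proof -
  obtain U' V' where "openin T U'" "\<one> \<in> U'" "U' \<subseteq> U" "openin T V'" "\<one> \<in> V'" "V' \<subseteq> V"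
    using assms unfolding identity_nbhd_def by blast
  moreover from this have "openin T (U' \<inter> V')" by blast
  ultimately show ?thesis using assms(1) unfolding identity_nbhd_def by (intro conjI exI[of _ "U' \<inter> V'"]) auto
qed

lemma identity_nbhd_conj:
  assumes U: "identity_nbhd G T U" and g: "g \<in> carrier G"
  shows "identity_nbhd G T {x \<in> carrier G. g \<otimes> x \<otimes> inv g \<in> U}"
proof -
  obtain U' where U': "openin T U'" "\<one> \<in> U'" "U' \<subseteq> U"
    using U unfolding identity_nbhd_def by blast
  have "continuous_map T T (\<lambda>x. g \<otimes> x \<otimes> inv g)"
    using continuous_map_compose[OF continuous_mult_left[OF g] continuous_mult_right[of "inv g"]] g
    by (simp add: o_def)
  then have "openin T {x \<in> topspace T. g \<otimes> x \<otimes> inv g \<in> U'}"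
    using U'(1) by (rule openin_continuous_map_preimage)
  then show ?thesis
    unfolding identity_nbhd_def using U' g
    by (intro conjI exI[of _ "{x \<in> topspace T. g \<otimes> x \<otimes> inv g \<in> U'}"]) (auto simp: topspace_eq)
qed

definition translate :: "'a \<Rightarrow> ('a \<Rightarrow> real) \<Rightarrow> 'a \<Rightarrow> real" where
  "translate g f = compose (carrier G) f (\<lambda>x. g \<otimes> x)"

lemma translate_apply: "x \<in> carrier G \<Longrightarrow> translate g f x = f (g \<otimes> x)"
  by (simp add: translate_def compose_def)

lemma translate_translate:
  "g \<in> carrier G \<Longrightarrow> h \<in> carrier G \<Longrightarrow> translate g (translate h f) = translate (h \<otimes> g) f"
  by (auto simp: translate_def compose_def fun_eq_iff m_assoc)

lemma translate_one: "f \<in> extensional (carrier G) \<Longrightarrow> translate \<one> f = f"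
  by (auto simp: translate_def compose_def fun_eq_iff extensional_def)

lemma UCb_rightD:
  assumes "f \<in> UCb_right G T"
  shows "f \<in> extensional (carrier G)" "bounded (f ` carrier G)"
    and "0 < \<epsilon> \<Longrightarrow> \<exists>U. identity_nbhd G T U \<and>
      (\<forall>x\<in>carrier G. \<forall>y\<in>carrier G. x \<otimes> inv y \<in> U \<longrightarrow> \<bar>f x - f y\<bar> \<le> \<epsilon>)"
  using assms by (auto simp: UCb_right_def)

lemma UCb_right_space: "bounded_function_space (carrier G) (UCb_right G T)"
proof
  show "carrier G \<noteq> {}" using one_closed by blast
  fix f assume f: "f \<in> UCb_right G T"
  show "f \<in> extensional (carrier G)" "bounded (f ` carrier G)" using UCb_rightD[OF f] by auto
  obtain B where B: "\<And>x. x \<in> carrier G \<Longrightarrow> \<bar>f x\<bar> \<le> B"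
    using UCb_rightD(2)[OF f] by (auto simp: bounded_iff)
  show "(\<lambda>x\<in>carrier G. c * f x) \<in> UCb_right G T" for c
    unfolding UCb_right_def
  proof (intro CollectI conjI allI impI)
    have "\<bar>c * f x\<bar> \<le> \<bar>c\<bar> * B" if "x \<in> carrier G" for x
      using B[OF that] by (simp add: abs_mult mult_left_mono)
    then show "bounded ((\<lambda>x\<in>carrier G. c * f x) ` carrier G)"
      by (auto simp: bounded_iff)
    fix \<epsilon> :: real assume "0 < \<epsilon>"
    then have "0 < \<epsilon> / (\<bar>c\<bar> + 1)" by simp
    from UCb_rightD(3)[OF f this] obtain U where U: "identity_nbhd G T U"
      "\<And>x y. x \<in> carrier G \<Longrightarrow> y \<in> carrier G \<Longrightarrow> x \<otimes> inv y \<in> U \<Longrightarrow> \<bar>f x - f y\<bar> \<le> \<epsilon> / (\<bar>c\<bar> + 1)"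
      by blast
    have "\<bar>c * f x - c * f y\<bar> \<le> \<epsilon>" if "x \<in> carrier G" "y \<in> carrier G" "x \<otimes> inv y \<in> U" for x y
    proof -
      have "\<bar>c * f x - c * f y\<bar> = \<bar>c\<bar> * \<bar>f x - f y\<bar>"
        by (simp add: abs_mult flip: right_diff_distrib)
      also have "\<dots> \<le> (\<bar>c\<bar> + 1) * (\<epsilon> / (\<bar>c\<bar> + 1))"
        using U(2)[OF that] by (intro mult_mono) auto
      finally show ?thesis by simp
    qed
    then show "\<exists>U. identity_nbhd G T U \<and> (\<forall>x\<in>carrier G. \<forall>y\<in>carrier G. x \<otimes> inv y \<in> U \<longrightarrow>
        \<bar>(\<lambda>x\<in>carrier G. c * f x) x - (\<lambda>x\<in>carrier G. c * f x) y\<bar> \<le> \<epsilon>)"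
      using U(1) by auto
  qed simp
  fix h assume h: "h \<in> UCb_right G T"
  obtain B' where B': "\<And>x. x \<in> carrier G \<Longrightarrow> \<bar>h x\<bar> \<le> B'"
    using UCb_rightD(2)[OF h] by (auto simp: bounded_iff)
  show "(\<lambda>x\<in>carrier G. f x + h x) \<in> UCb_right G T"
    unfolding UCb_right_def
  proof (intro CollectI conjI allI impI)
    have "\<bar>f x + h x\<bar> \<le> B + B'" if "x \<in> carrier G" for x
      using B[OF that] B'[OF that] by simp
    then show "bounded ((\<lambda>x\<in>carrier G. f x + h x) ` carrier G)"
      by (auto simp: bounded_iff)
    fix \<epsilon> :: real assume "0 < \<epsilon>"
    then have "0 < \<epsilon> / 2" by simp
    from UCb_rightD(3)[OF f this] obtain U where U: "identity_nbhd G T U"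
      "\<And>x y. x \<in> carrier G \<Longrightarrow> y \<in> carrier G \<Longrightarrow> x \<otimes> inv y \<in> U \<Longrightarrow> \<bar>f x - f y\<bar> \<le> \<epsilon> / 2"
      by blast
    from UCb_rightD(3)[OF h \<open>0 < \<epsilon> / 2\<close>] obtain V where V: "identity_nbhd G T V"
      "\<And>x y. x \<in> carrier G \<Longrightarrow> y \<in> carrier G \<Longrightarrow> x \<otimes> inv y \<in> V \<Longrightarrow> \<bar>h x - h y\<bar> \<le> \<epsilon> / 2"
      by blast
    have "\<bar>f x + h x - (f y + h y)\<bar> \<le> \<epsilon>"
      if "x \<in> carrier G" "y \<in> carrier G" "x \<otimes> inv y \<in> U \<inter> V" for x y
      using U(2)[of x y] V(2)[of x y] that by (simp add: abs_if split: if_splits)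
    then show "\<exists>U. identity_nbhd G T U \<and> (\<forall>x\<in>carrier G. \<forall>y\<in>carrier G. x \<otimes> inv y \<in> U \<longrightarrow>
        \<bar>(\<lambda>x\<in>carrier G. f x + h x) x - (\<lambda>x\<in>carrier G. f x + h x) y\<bar> \<le> \<epsilon>)"
      using identity_nbhd_Int[OF U(1) V(1)] by (intro exI[of _ "U \<inter> V"]) auto
  qed simp
next
  fix c :: real
  have "bounded ((\<lambda>x\<in>carrier G. c) ` carrier G)"
    by (rule bounded_subset[of "{c}"]) auto
  moreover have "\<exists>U. identity_nbhd G T U \<and> (\<forall>x\<in>carrier G. \<forall>y\<in>carrier G. x \<otimes> inv y \<in> U \<longrightarrow>
        \<bar>(\<lambda>x\<in>carrier G. c) x - (\<lambda>x\<in>carrier G. c) y\<bar> \<le> \<epsilon>)" if "0 < \<epsilon>" for \<epsilon> :: real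
    using identity_nbhd_carrier that by (intro exI[of _ "carrier G"]) auto
  ultimately show "(\<lambda>x\<in>carrier G. c) \<in> UCb_right G T" unfolding UCb_right_def by simp
qed

sublocale UCb: bounded_function_space "carrier G" "UCb_right G T"
  by (rule UCb_right_space)

text \<open>Left translation by \<open>g\<close> conjugates the quotient \<open>x y\<^sup>-\<^sup>1\<close> by \<open>g\<close>, and conjugation is continuous.\<close>

lemma translate_UCb:
  assumes f: "f \<in> UCb_right G T" and g: "g \<in> carrier G"
  shows "translate g f \<in> UCb_right G T"
  unfolding UCb_right_def
proof (intro CollectI conjI allI impI)
  show "translate g f \<in> extensional (carrier G)" by (simp add: translate_def)
  have "translate g f ` carrier G \<subseteq> f ` carrier G" using g by (auto simp: translate_apply)
  then show "bounded (translate g f ` carrier G)"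
    using UCb_rightD(2)[OF f] by (rule bounded_subset[rotated])
  fix \<epsilon> :: real assume "0 < \<epsilon>"
  from UCb_rightD(3)[OF f this] obtain U where U: "identity_nbhd G T U"
    "\<And>x y. x \<in> carrier G \<Longrightarrow> y \<in> carrier G \<Longrightarrow> x \<otimes> inv y \<in> U \<Longrightarrow> \<bar>f x - f y\<bar> \<le> \<epsilon>" by blast
  have "\<bar>translate g f x - translate g f y\<bar> \<le> \<epsilon>"
    if "x \<in> carrier G" "y \<in> carrier G" "x \<otimes> inv y \<in> {x \<in> carrier G. g \<otimes> x \<otimes> inv g \<in> U}" for x y
  proof -
    have "(g \<otimes> x) \<otimes> inv (g \<otimes> y) = g \<otimes> (x \<otimes> inv y) \<otimes> inv g"
      using that g by (simp add: inv_mult_group m_assoc)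
    then show ?thesis using U(2)[of "g \<otimes> x" "g \<otimes> y"] that g by (simp add: translate_apply)
  qed
  then show "\<exists>U. identity_nbhd G T U \<and> (\<forall>x\<in>carrier G. \<forall>y\<in>carrier G. x \<otimes> inv y \<in> U \<longrightarrow>
      \<bar>translate g f x - translate g f y\<bar> \<le> \<epsilon>)"
    using identity_nbhd_conj[OF U(1) g] by blast
qed

lemma amenable_groupI:
  assumes "mean_on (carrier G) (UCb_right G T) \<nu>"
    and "\<And>f g. f \<in> UCb_right G T \<Longrightarrow> g \<in> carrier G \<Longrightarrow> \<nu> (translate g f) = \<nu> f"
  shows "amenable_group G T"
  using assms unfolding amenable_group_def translate_def by blast


section \<open>Flows of amenable groups\<close>

text \<open>The right uniformity is the correct one here: if \<open>h = x y\<^sup>-\<^sup>1\<close> is close to the identity, then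
  \<open>\<alpha>(x) x\<^sub>0 = \<alpha>(h) (\<alpha>(y) x\<^sub>0)\<close> is close to \<open>\<alpha>(y) x\<^sub>0\<close>, uniformly in \<open>y\<close>, since \<open>\<alpha>(h)\<close> is uniformly close
  to the identity map.\<close>

lemma orbit_function_UCb:
  assumes \<alpha>: "flow G T X \<alpha>" and f: "f \<in> continuous_functions X" and x0: "x0 \<in> topspace X"
  shows "(\<lambda>g\<in>carrier G. f (\<alpha> g x0)) \<in> UCb_right G T"
  unfolding UCb_right_def
proof (intro CollectI conjI allI impI)
  interpret C: bounded_function_space "topspace X" "continuous_functions X"
    using flowD(1,2)[OF \<alpha>] by (intro continuous_functions_space)
  have fc: "continuous_map X euclideanreal f" using f by (simp add: continuous_functions_def)
  have "(\<lambda>g\<in>carrier G. f (\<alpha> g x0)) ` carrier G \<subseteq> f ` topspace X"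
    using flowD(6)[OF \<alpha> _ x0] by auto
  then show "bounded ((\<lambda>g\<in>carrier G. f (\<alpha> g x0)) ` carrier G)"
    using C.bounded[OF f] by (rule bounded_subset[rotated])
  fix \<epsilon> :: real assume \<epsilon>: "0 < \<epsilon>"
  define E where "E = {z \<in> topspace (prod_topology X X). f (fst z) - f (snd z) \<in> {-\<epsilon><..<\<epsilon>}}"
  have "continuous_map (prod_topology X X) euclideanreal (\<lambda>z. f (fst z) - f (snd z))"
    using continuous_map_compose[OF continuous_map_fst fc] continuous_map_compose[OF continuous_map_snd fc]
    by (intro continuous_map_diff) (auto simp: o_def)
  then have "openin (prod_topology X X) E"
    unfolding E_def by (rule openin_continuous_map_preimage) simp
  then have "E \<in> diagonal_nbhds X"
    using \<epsilon> by (auto simp: diagonal_nbhds_def E_def intro!: exI[of _ E])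
  then obtain V where V: "openin T V" "\<one> \<in> V" "\<And>h x. h \<in> V \<Longrightarrow> x \<in> topspace X \<Longrightarrow> (\<alpha> \<one> x, \<alpha> h x) \<in> E"
    using flow_uniform_nbhd[OF \<alpha>, of \<one>] topspace_eq by (metis one_closed)
  have "identity_nbhd G T V"
    using V(1,2) openin_subset[OF V(1)] by (auto simp: identity_nbhd_def topspace_eq)
  moreover have "\<bar>f (\<alpha> x x0) - f (\<alpha> y x0)\<bar> \<le> \<epsilon>"
    if xy: "x \<in> carrier G" "y \<in> carrier G" "x \<otimes> inv y \<in> V" for x y
  proof -
    have y: "\<alpha> y x0 \<in> topspace X" by (rule flowD(6)[OF \<alpha> xy(2) x0])
    have "\<alpha> (x \<otimes> inv y) (\<alpha> y x0) = \<alpha> x x0"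
      using flowD(7)[OF \<alpha> _ xy(2) x0, of "x \<otimes> inv y"] xy by (simp add: m_assoc)
    moreover have "\<alpha> \<one> (\<alpha> y x0) = \<alpha> y x0" by (rule flow_one[OF is_group \<alpha> y])
    ultimately show ?thesis using V(3)[OF xy(3) y] by (auto simp: E_def)
  qed
  ultimately show "\<exists>U. identity_nbhd G T U \<and> (\<forall>x\<in>carrier G. \<forall>y\<in>carrier G. x \<otimes> inv y \<in> U \<longrightarrow>
      \<bar>(\<lambda>g\<in>carrier G. f (\<alpha> g x0)) x - (\<lambda>g\<in>carrier G. f (\<alpha> g x0)) y\<bar> \<le> \<epsilon>)"
    by (intro exI[of _ V]) simp
qed simp

text \<open>An orbit map intertwines the action on \<open>X\<close> with left translations of \<open>G\<close>, so composing functions with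
  it carries the invariant mean of the group to an invariant mean of the flow.\<close>

lemma amenable_flow_if_amenable_group:
  assumes am: "amenable_group G T" and \<alpha>: "flow G T X \<alpha>"
  shows "amenable_flow G T X \<alpha>"
proof -
  interpret C: bounded_function_space "topspace X" "continuous_functions X"
    using flowD(1,2)[OF \<alpha>] by (intro continuous_functions_space)
  obtain x0 where x0: "x0 \<in> topspace X" using flowD(1)[OF \<alpha>] by blast
  obtain \<nu> where \<nu>: "mean_on (carrier G) (UCb_right G T) \<nu>"
    and inv: "\<And>f g. f \<in> UCb_right G T \<Longrightarrow> g \<in> carrier G \<Longrightarrow> \<nu> (translate g f) = \<nu> f"
    using am unfolding amenable_group_def translate_def by blast
  define orb where "orb f = (\<lambda>g\<in>carrier G. f (\<alpha> g x0))" for f :: "_ \<Rightarrow> real"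
  have orb: "orb f \<in> UCb_right G T" if "f \<in> continuous_functions X" for f
    unfolding orb_def by (rule orbit_function_UCb[OF \<alpha> that x0])
  have in_X: "\<alpha> g x0 \<in> topspace X" if "g \<in> carrier G" for g
    by (rule flowD(6)[OF \<alpha> that x0])
  have "mean_on (topspace X) (continuous_functions X) (\<lambda>f. \<nu> (orb f))"
  proof (rule C.mean_onI)
    fix f h assume fh: "f \<in> continuous_functions X" "h \<in> continuous_functions X"
    have "orb (\<lambda>x\<in>topspace X. f x + h x) = (\<lambda>g\<in>carrier G. orb f g + orb h g)"
      using in_X by (auto simp: orb_def)
    then show "\<nu> (orb (\<lambda>x\<in>topspace X. f x + h x)) = \<nu> (orb f) + \<nu> (orb h)"
      using UCb.mean_add[OF \<nu> orb[OF fh(1)] orb[OF fh(2)]] by simp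
  next
    fix c f assume f: "f \<in> continuous_functions X"
    have "orb (\<lambda>x\<in>topspace X. c * f x) = (\<lambda>g\<in>carrier G. c * orb f g)"
      using in_X by (auto simp: orb_def)
    then show "\<nu> (orb (\<lambda>x\<in>topspace X. c * f x)) = c * \<nu> (orb f)"
      using UCb.mean_scale[OF \<nu> orb[OF f]] by simp
  next
    fix c f assume f: "f \<in> continuous_functions X" "\<And>x. x \<in> topspace X \<Longrightarrow> c \<le> f x"
    show "c \<le> \<nu> (orb f)"
      by (rule UCb.mean_ge[OF \<nu> orb[OF f(1)]]) (simp add: orb_def f(2) in_X)
  qed
  moreover have "\<nu> (orb (compose (topspace X) f (\<alpha> g))) = \<nu> (orb f)"
    if f: "f \<in> continuous_functions X" and g: "g \<in> carrier G" for f g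
  proof -
    have "orb (compose (topspace X) f (\<alpha> g)) = translate g (orb f)"
      using in_X flowD(7)[OF \<alpha> g _ x0] g
      by (auto simp: orb_def translate_def compose_def)
    then show ?thesis using inv[OF orb[OF f] g] by simp
  qed
  ultimately show ?thesis using \<alpha> unfolding amenable_flow_def by blast
qed


section \<open>The action on means\<close>

text \<open>Since \<open>translate\<close> reverses products (\<open>translate_translate\<close>), its dual is a left action.\<close>

definition act :: "'a \<Rightarrow> (('a \<Rightarrow> real) \<Rightarrow> real) \<Rightarrow> ('a \<Rightarrow> real) \<Rightarrow> real" where
  "act g k = (\<lambda>f\<in>UCb_right G T. k (translate g f))"

lemma act_apply: "f \<in> UCb_right G T \<Longrightarrow> act g k f = k (translate g f)"
  by (simp add: act_def)

lemma act_means: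
  assumes k: "k \<in> UCb.means" and g: "g \<in> carrier G"
  shows "act g k \<in> UCb.means"
proof -
  note k' = UCb.means_mean_on[OF k]
  have "mean_on (carrier G) (UCb_right G T) (act g k)"
  proof (rule UCb.mean_onI)
    fix f h assume fh: "f \<in> UCb_right G T" "h \<in> UCb_right G T"
    have "translate g (\<lambda>x\<in>carrier G. f x + h x) = (\<lambda>x\<in>carrier G. translate g f x + translate g h x)"
      using g by (auto simp: translate_def compose_def)
    then show "act g k (\<lambda>x\<in>carrier G. f x + h x) = act g k f + act g k h"
      using UCb.mean_add[OF k' translate_UCb[OF fh(1) g] translate_UCb[OF fh(2) g]]
      by (simp add: act_apply fh UCb.add)
  next
    fix c f assume f: "f \<in> UCb_right G T"
    have "translate g (\<lambda>x\<in>carrier G. c * f x) = (\<lambda>x\<in>carrier G. c * translate g f x)"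
      using g by (auto simp: translate_def compose_def)
    then show "act g k (\<lambda>x\<in>carrier G. c * f x) = c * act g k f"
      using UCb.mean_scale[OF k' translate_UCb[OF f g]] by (simp add: act_apply f UCb.scale)
  next
    fix c f assume f: "f \<in> UCb_right G T" "\<And>x. x \<in> carrier G \<Longrightarrow> c \<le> f x"
    then show "c \<le> act g k f"
      using UCb.mean_ge[OF k' translate_UCb[OF f(1) g], of c] g
      by (simp add: act_apply translate_apply)
  qed
  then show ?thesis by (simp add: UCb.means_def act_def)
qed

text \<open>The means form a compact convex set on which \<open>G\<close> acts by affine maps; \<open>G\<close> is amenable exactly if
  there is a fixed point.\<close>

definition affine_subflow :: "(('a \<Rightarrow> real) \<Rightarrow> real) set \<Rightarrow> bool" where
  "affine_subflow K \<longleftrightarrow> closedin (top_of_set UCb.means) K \<and> K \<noteq> {} \<and> UCb.convex_functionals K \<and>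
     (\<forall>g\<in>carrier G. \<forall>k\<in>K. act g k \<in> K)"

text \<open>A fixed point forms an irreducible affine subflow.  In any other irreducible affine subflow some
  \<open>k \<mapsto> k(f)\<close> is not constant, while every orbit comes arbitrarily close to both its extremes (\<open>irreducible_orbits_reach\<close>).\<close>

definition irreducible_affine_subflow :: "(('a \<Rightarrow> real) \<Rightarrow> real) set \<Rightarrow> bool" where
  "irreducible_affine_subflow K \<longleftrightarrow>
     affine_subflow K \<and> (\<forall>C\<subseteq>K. affine_subflow C \<longrightarrow> C = K)"

lemma ex_irreducible_affine_subflow: "\<exists>K. irreducible_affine_subflow K"
proof -
  let ?X = "top_of_set UCb.means"
  define P where "P C \<longleftrightarrow> UCb.convex_functionals C \<and> (\<forall>g\<in>carrier G. \<forall>k\<in>C. act g k \<in> C)" for C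
  have cpt: "compact_space ?X"
    using UCb.compact_means by (simp add: compact_space_subtopology)
  have "(\<lambda>f\<in>UCb_right G T. f \<one>) \<in> UCb.means" by (rule UCb.point_evaluation_means) simp
  then have ne: "UCb.means \<noteq> {}" by blast
  have PM: "P UCb.means" using UCb.convex_means act_means by (auto simp: P_def)
  have PI: "P (\<Inter>\<C>)" if "\<C> \<noteq> {}" "\<And>C. C \<in> \<C> \<Longrightarrow> P C" for \<C>
    using that unfolding P_def UCb.convex_functionals_def by (simp add: Ball_def)
  have clo: "closedin ?X UCb.means" by simp
  have aff: "affine_subflow C \<longleftrightarrow> C \<noteq> {} \<and> closedin ?X C \<and> P C" for C
    unfolding affine_subflow_def P_def by blast
  show ?thesis
  proof (rule minimal_closed_set[where P = P, OF cpt clo ne PM PI])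
    fix K assume K: "closedin ?X K" "K \<noteq> {}" "P K"
      and min: "\<And>C. C \<subseteq> K \<Longrightarrow> closedin ?X C \<Longrightarrow> C \<noteq> {} \<Longrightarrow> P C \<Longrightarrow> C = K"
    have "irreducible_affine_subflow K"
      unfolding irreducible_affine_subflow_def aff using K min by blast
    then show ?thesis ..
  qed
qed

text \<open>The members of \<open>K\<close> whose whole orbit stays in the closed half-space \<open>\<sigma> k(f) \<le> r\<close> form a closed convex
  invariant set without \<open>k\<^sub>0\<close>, which is empty by irreducibility.  So every orbit enters the opposite open
  half-space, and by compactness finitely many group elements achieve this for all of \<open>K\<close>.  The sign
  \<open>\<sigma> = \<plusminus>1\<close> selects the maximum or the minimum of \<open>f\<close>.\<close>

lemma irreducible_orbits_reach:
  assumes K: "irreducible_affine_subflow K" and f: "f \<in> UCb_right G T"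
    and k0: "k0 \<in> K" "r < \<sigma> * k0 f"
  obtains J where "finite J" "J \<subseteq> carrier G" "\<And>k. k \<in> K \<Longrightarrow> \<exists>g\<in>J. r < \<sigma> * k (translate g f)"
proof -
  have KM: "closedin (top_of_set UCb.means) K" and conv: "UCb.convex_functionals K"
    and act: "\<And>g k. g \<in> carrier G \<Longrightarrow> k \<in> K \<Longrightarrow> act g k \<in> K"
    and min: "\<And>C. C \<subseteq> K \<Longrightarrow> affine_subflow C \<Longrightarrow> C = K"
    using K by (auto simp: irreducible_affine_subflow_def affine_subflow_def)
  have cpt: "compact K" using UCb.compact_means KM by (rule closedin_compact)
  define C where "C = {k \<in> K. \<forall>g\<in>carrier G. \<sigma> * k (translate g f) \<le> r}"
  have "closed {k. \<forall>g\<in>carrier G. \<sigma> * k (translate g f) \<le> r}"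
    unfolding Ball_def
    by (intro closed_Collect_all closed_Collect_imp closed_Collect_le continuous_intros) simp_all
  then have "closedin (top_of_set UCb.means)
      (K \<inter> (UCb.means \<inter> {k. \<forall>g\<in>carrier G. \<sigma> * k (translate g f) \<le> r}))"
    using KM by (intro closedin_Int closedin_closed_Int)
  moreover have "K \<inter> (UCb.means \<inter> {k. \<forall>g\<in>carrier G. \<sigma> * k (translate g f) \<le> r}) = C"
    using closedin_imp_subset[OF KM] unfolding C_def by blast
  ultimately have "closedin (top_of_set UCb.means) C" by simp
  moreover have "UCb.convex_functionals C"
    unfolding UCb.convex_functionals_def
  proof (intro allI impI)
    fix n and t :: "nat \<Rightarrow> real" and k :: "nat \<Rightarrow> ('a \<Rightarrow> real) \<Rightarrow> real"
    assume a: "(\<forall>i<n. 0 \<le> t i \<and> k i \<in> C) \<and> sum t {..<n} = 1"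
    have "\<sigma> * (\<Sum>i<n. t i * k i (translate g f)) \<le> r" if g: "g \<in> carrier G" for g
    proof -
      have "\<sigma> * (\<Sum>i<n. t i * k i (translate g f)) = (\<Sum>i<n. t i * (\<sigma> * k i (translate g f)))"
        by (simp add: sum_distrib_left mult.left_commute)
      also have "\<dots> \<le> (\<Sum>i<n. t i * r)"
        using a g by (intro sum_mono mult_left_mono) (auto simp: C_def)
      also have "\<dots> = r" using a by (simp flip: sum_distrib_right)
      finally show ?thesis .
    qed
    moreover have "\<forall>i<n. 0 \<le> t i \<and> k i \<in> K" using a by (auto simp: C_def)
    then have "(\<lambda>f\<in>UCb_right G T. \<Sum>i<n. t i * k i f) \<in> K"
      using conv a unfolding UCb.convex_functionals_def by blast
    ultimately show "(\<lambda>f\<in>UCb_right G T. \<Sum>i<n. t i * k i f) \<in> C"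
      using translate_UCb[OF f] by (simp add: C_def)
  qed
  moreover have "act g k \<in> C" if "g \<in> carrier G" "k \<in> C" for g k
    using that act f by (auto simp: C_def act_apply translate_UCb translate_translate)
  moreover have "C \<noteq> K"
    using k0 translate_one[OF UCb_rightD(1)[OF f]] by (force simp: C_def)
  ultimately have "C = {}"
    using min[of C] unfolding affine_subflow_def C_def by blast
  then have cover: "K \<subseteq> (\<Union>g\<in>carrier G. {k. r < \<sigma> * k (translate g f)})"
    by (fastforce simp: C_def not_le)
  have op: "open {k. r < \<sigma> * k (translate g f)}" for g
    by (intro open_Collect_less continuous_intros continuous_on_product_coordinates)
  show thesis
  proof (rule compactE_image[OF cpt op cover])
    fix J assume "J \<subseteq> carrier G" "finite J" "K \<subseteq> (\<Union>g\<in>J. {k. r < \<sigma> * k (translate g f)})"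
    then show thesis by (intro that[of J]) auto
  qed
qed

text \<open>If \<open>g = h g'\<close> with \<open>h \<in> H\<close>, then \<open>g x\<close> and \<open>g' x\<close> lie in the same right coset of \<open>H\<close> for all \<open>x\<close>.\<close>

lemma means_translate_coset:
  assumes k: "k \<in> UCb.means" and f: "f \<in> UCb_right G T" and H: "subgroup H G"
    and osc: "\<And>x y. x \<in> carrier G \<Longrightarrow> y \<in> carrier G \<Longrightarrow> x \<otimes> inv y \<in> H \<Longrightarrow> \<bar>f x - f y\<bar> \<le> \<epsilon>"
    and gg: "g \<in> carrier G" "g' \<in> carrier G" "H #> g = H #> g'"
  shows "k (translate g f) \<le> k (translate g' f) + \<epsilon>"
proof (rule UCb.mean_close[OF UCb.means_mean_on[OF k] translate_UCb[OF f gg(1)] translate_UCb[OF f gg(2)]])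
  have "g \<in> H #> g'" using rcos_self[OF gg(1) H] gg(3) by simp
  then obtain h where h: "h \<in> H" "g = h \<otimes> g'" by (auto simp: r_coset_def)
  have hG: "h \<in> carrier G" using subgroup.subset[OF H] h(1) by blast
  fix x assume x: "x \<in> carrier G"
  have "(g \<otimes> x) \<otimes> inv (g' \<otimes> x) = h \<otimes> (g' \<otimes> x) \<otimes> inv (g' \<otimes> x)"
    using h(2) hG gg(2) x by (simp add: m_assoc)
  also have "\<dots> = h" using hG gg(2) x by (simp add: m_assoc)
  finally have "\<bar>f (g \<otimes> x) - f (g' \<otimes> x)\<bar> \<le> \<epsilon>"
    using h(1) gg x by (intro osc) auto
  then show "translate g f x \<le> translate g' f x + \<epsilon>" using x by (simp add: translate_apply)
qed


section \<open>From minimal subflows of coset cubes to the group\<close>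

text \<open>The coordinate at \<open>Hg\<close> is the coordinate at \<open>H\<close> composed with \<open>\<alpha>\<^sub>H(g)\<close>, so an invariant mean gives all
  coordinates the same value \<open>c\<close>.  On finitely many coordinates it is matched by a convex combination of
  points of \<open>Y\<close>; the combination depends on the finite set, the value \<open>c\<close> does not.\<close>

lemma amenable_flow_coset_values:
  assumes H: "open_subgroup G T H"
    and sub: "subflow G T (coset_cube G H) (coset_flow G H) Y \<beta>"
    and am: "amenable_flow G T (subtopology (coset_cube G H) Y) \<beta>"
  obtains c where "\<And>J. finite J \<Longrightarrow> J \<subseteq> carrier G \<Longrightarrow>
    \<exists>(R :: ('a set \<Rightarrow> nat) set) t y. finite R \<and> (\<forall>p\<in>R. 0 \<le> t p \<and> y p \<in> Y) \<and> (\<Sum>p\<in>R. t p) = 1 \<and>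
      (\<forall>g\<in>J. (\<Sum>p\<in>R. t p * real (y p (H #> g))) = c)"
proof -
  let ?X = "coset_cube G H" and ?I = "rcosets H"
  have HG: "H \<subseteq> carrier G" and sH: "subgroup H G"
    using H subgroup.subset by (auto simp: open_subgroup_def)
  have \<beta>: "\<beta> = (\<lambda>g. restrict (coset_flow G H g) Y)" and Y: "closedin ?X Y" "Y \<noteq> {}"
    and inv: "flow_invariant G (coset_flow G H) Y"
    using sub by (auto simp: subflow_def)
  have YX: "Y \<subseteq> topspace ?X" using Y(1) by (rule closedin_subset)
  then have top: "topspace (subtopology ?X Y) = Y" by auto
  obtain \<nu> where \<nu>: "mean_on Y (continuous_functions (subtopology ?X Y)) \<nu>"
    and \<nu>inv: "\<And>f g. f \<in> continuous_functions (subtopology ?X Y) \<Longrightarrow> g \<in> carrier G \<Longrightarrow>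
      \<nu> (compose Y f (\<beta> g)) = \<nu> f"
    using am unfolding amenable_flow_def top by blast
  define e where "e C = (\<lambda>\<phi>\<in>Y. real (\<phi> C))" for C
  have HI: "H \<in> ?I" by (metis HG coset_mult_one one_closed rcosetsI)
  have e: "e H \<in> continuous_functions (subtopology ?X Y)"
  proof -
    have "continuous_map (subtopology ?X Y) (discrete_topology {0, 1}) (\<lambda>\<phi>. \<phi> H)"
      unfolding coset_cube_def using HI
      by (intro continuous_map_from_subtopology continuous_map_product_projection)
    moreover have "continuous_map (discrete_topology {0, 1}) euclideanreal real" by simp
    ultimately have "continuous_map (subtopology ?X Y) euclideanreal (real \<circ> (\<lambda>\<phi>. \<phi> H))"
      by (rule continuous_map_compose)
    then have "continuous_map (subtopology ?X Y) euclideanreal (e H)"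
      by (rule continuous_map_eq) (simp add: top e_def)
    then show ?thesis unfolding continuous_functions_def top by (simp add: e_def)
  qed
  have eg: "\<nu> (e (H #> g)) = \<nu> (e H)" if g: "g \<in> carrier G" for g
  proof -
    have "e (H #> g) = compose Y (e H) (\<beta> g)"
    proof (rule ext)
      fix \<phi>
      show "e (H #> g) \<phi> = compose Y (e H) (\<beta> g) \<phi>"
      proof (cases "\<phi> \<in> Y")
        case True
        moreover have "coset_flow G H g \<phi> \<in> Y"
          using inv g True unfolding flow_invariant_def by blast
        moreover have "coset_flow G H g \<phi> H = \<phi> (H #> g)"
          using True YX HI by (auto simp: coset_flow_def)
        ultimately show ?thesis by (simp add: compose_def e_def \<beta>)
      qed (simp add: e_def compose_def)
    qed
    then show ?thesis using \<nu>inv[OF e g] by simp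
  qed
  show thesis
  proof (rule that[of "\<nu> (e H)"])
    fix J assume J: "finite J" "J \<subseteq> carrier G"
    have J': "finite ((\<lambda>g. H #> g) ` J)" "(\<lambda>g. H #> g) ` J \<subseteq> ?I"
      using J HG by (auto intro: rcosetsI)
    obtain R :: "('a set \<Rightarrow> nat) set" and t y where R: "finite R" "\<And>p. p \<in> R \<Longrightarrow> 0 \<le> t p"
      "(\<Sum>p\<in>R. t p) = 1" "\<And>p. p \<in> R \<Longrightarrow> y p \<in> Y"
      "\<And>i. i \<in> (\<lambda>g. H #> g) ` J \<Longrightarrow> \<nu> (\<lambda>\<phi>\<in>Y. real (\<phi> i)) = (\<Sum>p\<in>R. t p * real (y p i))"
      by (rule mean_on_cube_coordinates[of "{0, 1}" ?I Y \<nu> "(\<lambda>g. H #> g) ` J"])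
         (use Y \<nu> J' in \<open>auto simp: coset_cube_def\<close>)
    have "(\<Sum>p\<in>R. t p * real (y p (H #> g))) = \<nu> (e H)" if "g \<in> J" for g
      using R(5)[of "H #> g"] eg[of g] that J(2) by (auto simp: e_def)
    then show "\<exists>(R :: ('a set \<Rightarrow> nat) set) t y. finite R \<and> (\<forall>p\<in>R. 0 \<le> t p \<and> y p \<in> Y) \<and>
        (\<Sum>p\<in>R. t p) = 1 \<and> (\<forall>g\<in>J. (\<Sum>p\<in>R. t p * real (y p (H #> g))) = \<nu> (e H))"
      using R(1-4) by (intro exI[of _ R] exI[of _ t] exI[of _ y]) auto
  qed
qed

text \<open>The contradiction lies in the value \<open>c\<close> of the coordinates under an invariant mean on the subflow \<open>Y\<close>.
  The points of \<open>Y\<close> record, for some \<open>k\<close> in an irreducible affine subflow \<open>K\<close>, at which \<open>g\<close> the value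
  \<open>(g k)(f)\<close> is close to its maximum \<open>M\<close> or to its minimum \<open>m\<close> over \<open>K\<close>.  A convex combination of such \<open>k\<close>
  lies in \<open>K\<close> and can be moved close to \<open>M\<close>; then most of its parts are close to \<open>M\<close> as well.\<close>

lemma amenable_group_if_minimal_subflows_amenable:
  assumes na: "non_archimedean G T"
    and min_am: "\<And>H Y \<beta>. open_subgroup G T H \<Longrightarrow> subflow G T (coset_cube G H) (coset_flow G H) Y \<beta> \<Longrightarrow>
      minimal_flow G T (subtopology (coset_cube G H) Y) \<beta> \<Longrightarrow>
      amenable_flow G T (subtopology (coset_cube G H) Y) \<beta>"
  shows "amenable_group G T"
proof (rule ccontr)
  assume not_am: "\<not> amenable_group G T"
  obtain K where K: "irreducible_affine_subflow K"
    using ex_irreducible_affine_subflow by blast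
  then have KM: "closedin (top_of_set UCb.means) K" and Kne: "K \<noteq> {}"
    and conv: "UCb.convex_functionals K"
    and act: "\<And>g k. g \<in> carrier G \<Longrightarrow> k \<in> K \<Longrightarrow> act g k \<in> K"
    by (auto simp: irreducible_affine_subflow_def affine_subflow_def)
  have cpt: "compact K" using UCb.compact_means KM by (rule closedin_compact)
  have K_means: "k \<in> UCb.means" if "k \<in> K" for k
    using closedin_imp_subset[OF KM] that by blast
  \<comment> \<open>If every \<open>f\<close> were constant on the invariant set \<open>K\<close>, its elements would be invariant means.\<close>
  have "\<exists>f\<in>UCb_right G T. \<exists>k\<in>K. \<exists>k'\<in>K. k f < k' f"
  proof (rule ccontr)
    assume "\<not> (\<exists>f\<in>UCb_right G T. \<exists>k\<in>K. \<exists>k'\<in>K. k f < k' f)"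
    then have eq: "k f = k' f" if "f \<in> UCb_right G T" "k \<in> K" "k' \<in> K" for f k k'
      using that by (meson linorder_neqE)
    obtain k where k: "k \<in> K" using Kne by blast
    have "k (translate g f) = k f" if "f \<in> UCb_right G T" "g \<in> carrier G" for f g
      using eq[OF that(1) act[OF that(2) k] k] that by (simp add: act_apply)
    then have "amenable_group G T"
      using UCb.means_mean_on[OF K_means[OF k]] by (intro amenable_groupI)
    then show False using not_am by blast
  qed
  then obtain f k\<^sub>1 k\<^sub>2 where f: "f \<in> UCb_right G T" and k12: "k\<^sub>1 \<in> K" "k\<^sub>2 \<in> K" "k\<^sub>1 f < k\<^sub>2 f"
    by blast
  have cont: "continuous_on K (\<lambda>k. k f)"
    using continuous_on_product_coordinates by (rule continuous_on_subset) simp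
  obtain k\<^sub>M where kM: "k\<^sub>M \<in> K" "\<And>k. k \<in> K \<Longrightarrow> k f \<le> k\<^sub>M f"
    using continuous_attains_sup[OF cpt Kne cont] by blast
  obtain k\<^sub>m where km: "k\<^sub>m \<in> K" "\<And>k. k \<in> K \<Longrightarrow> k\<^sub>m f \<le> k f"
    using continuous_attains_inf[OF cpt Kne cont] by blast
  define M m d where "M = k\<^sub>M f" and "m = k\<^sub>m f" and "d = M - m"
  have d: "0 < d" using kM(2)[OF k12(2)] km(2)[OF k12(1)] k12(3) by (simp add: d_def M_def m_def)
  have bounds: "m \<le> k (translate g f)" "k (translate g f) \<le> M" if "k \<in> K" "g \<in> carrier G" for k g
    using kM(2)[OF act[OF that(2,1)]] km(2)[OF act[OF that(2,1)]] f
    by (simp_all add: act_apply M_def m_def)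
  obtain U where U: "identity_nbhd G T U"
    "\<And>x y. x \<in> carrier G \<Longrightarrow> y \<in> carrier G \<Longrightarrow> x \<otimes> inv y \<in> U \<Longrightarrow> \<bar>f x - f y\<bar> \<le> d / 3"
    using UCb_rightD(3)[OF f, of "d / 3"] d by auto
  obtain H where H: "open_subgroup G T H" "H \<subseteq> U"
    using na U(1) unfolding non_archimedean_def by blast
  then have sH: "subgroup H G" and HG: "H \<subseteq> carrier G"
    using subgroup.subset by (auto simp: open_subgroup_def)
  have osc: "k (translate g f) \<le> k (translate g' f) + d / 3"
    if "k \<in> K" "g \<in> carrier G" "g' \<in> carrier G" "H #> g = H #> g'" for k g g'
    by (rule means_translate_coset[OF K_means[OF that(1)] f sH _ that(2-4)]) (use U(2) H(2) in blast)
  let ?X = "coset_cube G H" and ?\<alpha> = "coset_flow G H" and ?I = "rcosets H"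
  have \<alpha>: "flow G T ?X ?\<alpha>" by (rule flow_coset_flow[OF topological H(1)])
  have topX: "topspace ?X = PiE ?I (\<lambda>_. {0, 1})" by (simp add: coset_cube_def)
  have gI: "H #> g \<in> ?I" if "g \<in> carrier G" for g using HG that by (rule rcosetsI)
  \<comment> \<open>Only values \<open>(g k)(f)\<close> in the outer thirds of \<open>[m, M]\<close> constrain \<open>\<phi>(Hg)\<close>: this makes the conditions closed,
     and the gap between the thirds keeps them consistent when \<open>g\<close> varies in its coset.\<close>
  define compat where "compat k \<phi> \<longleftrightarrow> (\<forall>g\<in>carrier G.
      (k (translate g f) \<le> M - d / 3 \<or> \<phi> (H #> g) = 1) \<and>
      (m + d / 3 \<le> k (translate g f) \<or> \<phi> (H #> g) = 0))" for k and \<phi> :: "'a set \<Rightarrow> nat"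
  define Z where "Z = {(k, \<phi>). k \<in> K \<and> \<phi> \<in> topspace ?X \<and> compat k \<phi>}"
  have "closedin ?X (snd ` Z)"
  proof (rule closedin_snd_image[OF _ flowD(2,3)[OF \<alpha>]])
    show "compact_space (top_of_set K)" using cpt by (simp add: compact_space_subtopology)
    let ?P = "prod_topology (top_of_set K) ?X"
    have cl1: "closedin ?P ({k \<in> K. Q k} \<times> topspace ?X \<union> K \<times> {\<phi> \<in> topspace ?X. \<phi> (H #> g) = a})"
      if Q: "closed {k. Q k}" and g: "g \<in> carrier G" and a: "a \<in> {0, 1}" for Q g a
    proof -
      have "closedin (top_of_set K) (K \<inter> {k. Q k})" using Q by (rule closedin_closed_Int)
      moreover have "K \<inter> {k. Q k} = {k \<in> K. Q k}" by blast
      ultimately have "closedin ?P ({k \<in> K. Q k} \<times> topspace ?X)"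
        by (simp only: closedin_prod_Times_iff closedin_topspace simp_thms)
      moreover have "closedin ?X {\<phi> \<in> topspace ?X. \<phi> (H #> g) \<in> {a}}"
      proof (rule closedin_continuous_map_preimage)
        show "continuous_map ?X (discrete_topology {0, 1}) (\<lambda>\<phi>. \<phi> (H #> g))"
          unfolding coset_cube_def by (rule continuous_map_product_projection[OF gI[OF g]])
        show "closedin (discrete_topology {0, 1}) {a}" using a by simp
      qed
      then have "closedin ?P (K \<times> {\<phi> \<in> topspace ?X. \<phi> (H #> g) = a})"
        by (simp only: closedin_prod_Times_iff closedin_subtopology_refl subset_UNIV topspace_euclidean
            singleton_iff simp_thms)
      ultimately show ?thesis by (rule closedin_Un)
    qed
    have coord: "continuous_on UNIV (\<lambda>k. k (translate g f))" for g
      by (rule continuous_on_product_coordinates)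
    have "closedin ?P (\<Inter>g\<in>carrier G.
       ({k \<in> K. k (translate g f) \<le> M - d / 3} \<times> topspace ?X \<union> K \<times> {\<phi> \<in> topspace ?X. \<phi> (H #> g) = 1}) \<inter>
       ({k \<in> K. m + d / 3 \<le> k (translate g f)} \<times> topspace ?X \<union> K \<times> {\<phi> \<in> topspace ?X. \<phi> (H #> g) = 0}))"
      using one_closed
      by (intro closedin_INT closedin_Int cl1 closed_Collect_le coord continuous_on_const) auto
    also have "(\<Inter>g\<in>carrier G.
       ({k \<in> K. k (translate g f) \<le> M - d / 3} \<times> topspace ?X \<union> K \<times> {\<phi> \<in> topspace ?X. \<phi> (H #> g) = 1}) \<inter>
       ({k \<in> K. m + d / 3 \<le> k (translate g f)} \<times> topspace ?X \<union> K \<times> {\<phi> \<in> topspace ?X. \<phi> (H #> g) = 0})) = Z"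
      (is "?Z = Z")
    proof (rule Set.set_eqI)
      fix z :: "(('a \<Rightarrow> real) \<Rightarrow> real) \<times> ('a set \<Rightarrow> nat)"
      obtain k \<phi> where z: "z = (k, \<phi>)" by force
      show "z \<in> ?Z \<longleftrightarrow> z \<in> Z"
        unfolding z Z_def compat_def using one_closed by auto
    qed
    finally show "closedin ?P Z" .
  qed
  moreover have "snd ` Z \<noteq> {}"
  proof -
    \<comment> \<open>The two demands on \<open>\<phi>\<close> cannot meet on one coset, since \<open>M - d/3\<close> and \<open>m + d/3\<close> differ by \<open>d/3\<close>,
       which bounds the oscillation on the coset.\<close>
    define \<phi> where "\<phi> = (\<lambda>C\<in>?I. if \<exists>g\<in>carrier G. C = H #> g \<and> M - d / 3 < k\<^sub>M (translate g f)
        then 1 else 0 :: nat)"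
    have "\<phi> \<in> topspace ?X" unfolding topX by (auto simp: \<phi>_def)
    moreover have "compat k\<^sub>M \<phi>"
      unfolding compat_def
    proof (intro ballI conjI)
      fix g assume g: "g \<in> carrier G"
      show "k\<^sub>M (translate g f) \<le> M - d / 3 \<or> \<phi> (H #> g) = 1"
        using g gI[OF g] by (auto simp: \<phi>_def not_le)
      show "m + d / 3 \<le> k\<^sub>M (translate g f) \<or> \<phi> (H #> g) = 0"
      proof (rule ccontr)
        assume a: "\<not> ?thesis"
        then obtain g' where "g' \<in> carrier G" "H #> g = H #> g'" "M - d / 3 < k\<^sub>M (translate g' f)"
          using gI[OF g] by (auto simp: \<phi>_def split: if_splits)
        then show False using osc[OF kM(1) _ g, of g'] a by (simp add: d_def field_simps)
      qed
    qed
    ultimately have "(k\<^sub>M, \<phi>) \<in> Z" using kM(1) by (simp add: Z_def)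
    then show ?thesis by blast
  qed
  moreover have "?\<alpha> g \<phi> \<in> snd ` Z" if g: "g \<in> carrier G" and \<phi>: "\<phi> \<in> snd ` Z" for g \<phi>
  proof -
    obtain k where k: "k \<in> K" "\<phi> \<in> topspace ?X" "compat k \<phi>" using \<phi> by (auto simp: Z_def)
    have "act g k (translate x f) = k (translate (x \<otimes> g) f) \<and> ?\<alpha> g \<phi> (H #> x) = \<phi> (H #> (x \<otimes> g))"
      if x: "x \<in> carrier G" for x
      using translate_UCb[OF f x] translate_translate[OF g x] k(2) gI[OF x] coset_mult_assoc[OF HG x g]
      by (simp add: act_apply coset_flow_def)
    then have "compat (act g k) (?\<alpha> g \<phi>)" using k(3) g unfolding compat_def by simp
    then have "(act g k, ?\<alpha> g \<phi>) \<in> Z"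
      using act[OF g k(1)] flowD(6)[OF \<alpha> g k(2)] by (simp add: Z_def)
    then show ?thesis by (rule rev_image_eqI) simp
  qed
  ultimately obtain Y where YZ: "Y \<subseteq> snd ` Z" and sub: "subflow G T ?X ?\<alpha> Y (\<lambda>g. restrict (?\<alpha> g) Y)"
    and minY: "minimal_flow G T (subtopology ?X Y) (\<lambda>g. restrict (?\<alpha> g) Y)"
    using ex_minimal_subflow[OF topological \<alpha>, of "snd ` Z"] by metis
  have "\<forall>y\<in>Y. \<exists>k. k \<in> K \<and> y \<in> topspace ?X \<and> compat k y" using YZ by (fastforce simp: Z_def)
  then obtain \<kappa> where \<kappa>: "\<And>y. y \<in> Y \<Longrightarrow> \<kappa> y \<in> K \<and> y \<in> topspace ?X \<and> compat (\<kappa> y) y" by metis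
  obtain c where c: "\<And>J. finite J \<Longrightarrow> J \<subseteq> carrier G \<Longrightarrow>
      \<exists>(R :: ('a set \<Rightarrow> nat) set) t y. finite R \<and> (\<forall>p\<in>R. 0 \<le> t p \<and> y p \<in> Y) \<and> (\<Sum>p\<in>R. t p) = 1 \<and>
      (\<forall>g\<in>J. (\<Sum>p\<in>R. t p * real (y p (H #> g))) = c)"
    using amenable_flow_coset_values[OF H(1) sub min_am[OF H(1) sub minY]] by blast
  \<comment> \<open>The margin \<open>d/9\<close> is a third of \<open>d/3\<close>: if an average lies within \<open>d/9\<close> of an end of \<open>[m, M]\<close>, less than
     a third of the weight lies outside the adjacent third.  These finite sets serve all of \<open>K\<close>, hence also a \<open>b\<close> constructed afterwards.\<close>
  have "M - d / 9 < 1 * k\<^sub>M f" using d by (simp add: M_def)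
  then obtain J\<^sub>1 where J1: "finite J\<^sub>1" "J\<^sub>1 \<subseteq> carrier G"
    "\<And>k. k \<in> K \<Longrightarrow> \<exists>g\<in>J\<^sub>1. M - d / 9 < 1 * k (translate g f)"
    using irreducible_orbits_reach[OF K f kM(1)] by metis
  have "- m - d / 9 < (-1) * k\<^sub>m f" using d by (simp add: m_def)
  then obtain J\<^sub>2 where J2: "finite J\<^sub>2" "J\<^sub>2 \<subseteq> carrier G"
    "\<And>k. k \<in> K \<Longrightarrow> \<exists>g\<in>J\<^sub>2. - m - d / 9 < (-1) * k (translate g f)"
    using irreducible_orbits_reach[OF K f km(1)] by metis
  have J: "finite (J\<^sub>1 \<union> J\<^sub>2)" "J\<^sub>1 \<union> J\<^sub>2 \<subseteq> carrier G" using J1(1,2) J2(1,2) by auto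
  obtain R :: "('a set \<Rightarrow> nat) set" and t y where R: "finite R"
    and ty: "\<forall>p\<in>R. 0 \<le> t p \<and> y p \<in> Y" and t1: "(\<Sum>p\<in>R. t p) = 1"
    and tcJ: "\<forall>g\<in>J\<^sub>1 \<union> J\<^sub>2. (\<Sum>p\<in>R. t p * real (y p (H #> g))) = c"
    using c[OF J] by (elim exE conjE) (rule that)
  have t: "\<And>p. p \<in> R \<Longrightarrow> 0 \<le> t p" "(\<Sum>p\<in>R. t p) = 1" and y: "\<And>p. p \<in> R \<Longrightarrow> y p \<in> Y"
    and tc: "\<And>g. g \<in> J\<^sub>1 \<union> J\<^sub>2 \<Longrightarrow> (\<Sum>p\<in>R. t p * real (y p (H #> g))) = c"
    using ty t1 tcJ by auto
  have compatD: "\<kappa> (y p) (translate g f) \<le> M - d / 3 \<or> y p (H #> g) = 1"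
      "m + d / 3 \<le> \<kappa> (y p) (translate g f) \<or> y p (H #> g) = 0"
    if "p \<in> R" "g \<in> carrier G" for p g
  proof -
    have "compat (\<kappa> (y p)) (y p)" using \<kappa>[OF y[OF that(1)]] by (elim conjE)
    from bspec[OF this[unfolded compat_def] that(2)]
    show "\<kappa> (y p) (translate g f) \<le> M - d / 3 \<or> y p (H #> g) = 1"
      "m + d / 3 \<le> \<kappa> (y p) (translate g f) \<or> y p (H #> g) = 0"
      by (rule conjunct1, rule conjunct2)
  qed
  \<comment> \<open>The barycentre of the \<open>k\<close> that the points \<open>y p\<close> record.\<close>
  define b where "b = (\<lambda>f\<in>UCb_right G T. \<Sum>p\<in>R. t p * \<kappa> (y p) f)"
  have bK: "b \<in> K"
    unfolding b_def using \<kappa> y t by (intro UCb.convex_functionalsD[OF conv R]) auto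
  have b: "b (translate g f) = (\<Sum>p\<in>R. t p * \<kappa> (y p) (translate g f))" if "g \<in> carrier G" for g
    using translate_UCb[OF f that] by (simp add: b_def)
  have val: "y p (H #> g) \<in> {0, 1}" if "p \<in> R" "g \<in> carrier G" for p g
    using \<kappa>[OF y[OF that(1)]] gI[OF that(2)] unfolding topX by (auto simp: PiE_iff)
  have "2 / 3 < c"
  proof -
    obtain g where g: "g \<in> J\<^sub>1" "M - d / 9 < b (translate g f)" using J1(3)[OF bK] by auto
    then have gG: "g \<in> carrier G" using J1(2) by blast
    have "\<kappa> (y p) (translate g f) \<le> (M - d / 3) + d / 3 * real (y p (H #> g))" if p: "p \<in> R" for p
      using compatD(1)[OF p gG] bounds(2)[OF _ gG, of "\<kappa> (y p)"] \<kappa>[OF y[OF p]] val[OF p gG] d by auto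
    then have "b (translate g f) \<le> (\<Sum>p\<in>R. t p * ((M - d / 3) + d / 3 * real (y p (H #> g))))"
      unfolding b[OF gG] using t(1) by (intro sum_mono mult_left_mono) auto
    also have "\<dots> = (\<Sum>p\<in>R. t p) * (M - d / 3) + d / 3 * (\<Sum>p\<in>R. t p * real (y p (H #> g)))"
      by (simp add: distrib_left sum.distrib sum_distrib_left sum_distrib_right mult.left_commute)
    also have "\<dots> = M - d / 3 + d / 3 * c" using t(2) tc[of g] g(1) by simp
    finally have "2 / 9 * d < d / 3 * c" using g(2) by simp
    then show ?thesis using d by (simp add: field_simps)
  qed
  moreover have "c < 1 / 3"
  proof -
    obtain g where g: "g \<in> J\<^sub>2" "b (translate g f) < m + d / 9" using J2(3)[OF bK] by auto
    then have gG: "g \<in> carrier G" using J2(2) by blast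
    have "m + d / 3 * real (y p (H #> g)) \<le> \<kappa> (y p) (translate g f)" if p: "p \<in> R" for p
      using compatD(2)[OF p gG] bounds(1)[OF _ gG, of "\<kappa> (y p)"] \<kappa>[OF y[OF p]] val[OF p gG] d by auto
    then have "(\<Sum>p\<in>R. t p * (m + d / 3 * real (y p (H #> g)))) \<le> b (translate g f)"
      unfolding b[OF gG] using t(1) by (intro sum_mono mult_left_mono) auto
    moreover have "(\<Sum>p\<in>R. t p * (m + d / 3 * real (y p (H #> g))))
        = (\<Sum>p\<in>R. t p) * m + d / 3 * (\<Sum>p\<in>R. t p * real (y p (H #> g)))"
      by (simp add: distrib_left sum.distrib sum_distrib_left sum_distrib_right mult.left_commute)
    then have "(\<Sum>p\<in>R. t p * (m + d / 3 * real (y p (H #> g)))) = m + d / 3 * c"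
      using t(2) tc[of g] g(1) by simp
    ultimately have "d / 3 * c < d / 9" using g(2) by linarith
    then show ?thesis using d by (simp add: field_simps)
  qed
  ultimately show False by simp
qed

end

theorem corollary7p3:
  fixes G :: "('g, 'm) monoid_scheme" and T :: "'g topology"
  assumes "topological_group G T"
    and "Hausdorff_space T"
    and "non_archimedean G T"
  shows "amenable_group G T \<longleftrightarrow>
    (\<forall>H. open_subgroup G T H \<longrightarrow>
      (\<forall>Y \<beta>. subflow G T (coset_cube G H) (coset_flow G H) Y \<beta> \<and>
              minimal_flow G T (subtopology (coset_cube G H) Y) \<beta> \<longrightarrow>
              amenable_flow G T (subtopology (coset_cube G H) Y) \<beta>))"
proof -
  interpret topological_grp G T
    using assms(1) by (simp add: topological_grp_def topological_grp_axioms_def topological_group_def)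
  show ?thesis
    using amenable_flow_if_amenable_group amenable_group_if_minimal_subflows_amenable[OF assms(3)]
    unfolding subflow_def by blast
qed

end
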